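(* Let $A$ be a finite set with $k\ge 1$ elements and fix a point $*\in A$. Every tree with vertex set $A$ (having $k-1$ edges) defines, after choosing an orientation of the corresponding $(k-2)$-dimensional face of $\Delta(A)$, a $(k-2)$-dimensional cycle of the complex $K(A)$. The homology classes of the $(k-1)!$ trees with vertex set $A$ which are homeomorphic to a segment (i.e., all vertices have order $1$ or $2$) and one of whose endpoints (vertices of order $1$) is the point $*$ form a basis of the group $H_{k-2}(K(A);\mathbb{Z})$.
   Context: Let $A$ be a finite set with $k$ elements. $\Delta(A)$ denotes the simplex with $\binom{k}{2}$ vertices, in one-to-one correspondence with the two-element subsets of $A$. A face of $\Delta(A)$ is identified with the graph with vertex set $A$ whose edges are the two-element subsets corresponding to the vertices of the face. A graph is connected if any two points of $A$ can be joined by a chain of its edges. $M(A)$ is the subcomplex of $\Delta(A)$ consisting of all faces whose graphs are non-connected. The complex of connected graphs is the quotient chain complex $K(A)=\Delta(A)/M(A)$ (simplicial chains of $\Delta(A)$ modulo those of $M(A)$, with the empty face regarded as a face of dimension $-1$). *)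

theory Defs
  imports "HOL-Algebra.Free_Abelian_Groups"
begin

section \<open>Chains of pairs of simplicial complexes\<close>

text \<open>
  An abstract simplicial complex is the set of its faces, the empty face (of dimension -1)
  included. Faces are oriented by means of a linear order \<open>r\<close> on the vertices: the generator
  \<open>frag_of F\<close> is the face \<open>F\<close> with its vertices listed in increasing order, and
  \<open>- frag_of F\<close> is the same face with the opposite orientation.
\<close>

type_synonym 'v chain = "'v set \<Rightarrow>\<^sub>0 int"

definition faces :: "'v set set \<Rightarrow> int \<Rightarrow> 'v set set" where
  "faces X d = {F \<in> X. finite F \<and> int (card F) = d + 1}"

definition chains :: "'v set set \<Rightarrow> int \<Rightarrow> 'v chain monoid" where
  "chains X d = free_Abelian_group (faces X d)"

definition bd :: "('v \<times> 'v) set \<Rightarrow> 'v chain \<Rightarrow> 'v chain" where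
  "bd r = frag_extend
     (\<lambda>F. \<Sum>v\<in>F. frag_cmul ((-1) ^ card {w \<in> F - {v}. (w, v) \<in> r}) (frag_of (F - {v})))"

text \<open>The quotient complex of the chains of \<open>X\<close> by the chains of a subcomplex \<open>Y\<close>.\<close>

definition quot_chains :: "'v set set \<Rightarrow> 'v set set \<Rightarrow> int \<Rightarrow> 'v chain set monoid" where
  "quot_chains X Y d = chains X d Mod carrier (chains Y d)"

definition quot_class :: "'v set set \<Rightarrow> 'v set set \<Rightarrow> int \<Rightarrow> 'v chain \<Rightarrow> 'v chain set" where
  "quot_class X Y d c = carrier (chains Y d) #>\<^bsub>chains X d\<^esub> c"

text \<open>
  The boundary induced on cosets. The image below is a singleton as soon as \<open>X\<close> and \<open>Y\<close> are
  closed under taking subsets; see \<open>quot_bd_class\<close>.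
\<close>

definition quot_bd ::
  "('v \<times> 'v) set \<Rightarrow> 'v set set \<Rightarrow> 'v set set \<Rightarrow> int \<Rightarrow> 'v chain set \<Rightarrow> 'v chain set" where
  "quot_bd r X Y d Q = the_elem ((\<lambda>c. quot_class X Y (d - 1) (bd r c)) ` Q)"

definition quot_cycles ::
  "('v \<times> 'v) set \<Rightarrow> 'v set set \<Rightarrow> 'v set set \<Rightarrow> int \<Rightarrow> 'v chain set set" where
  "quot_cycles r X Y d =
     kernel (quot_chains X Y d) (quot_chains X Y (d - 1)) (quot_bd r X Y d)"

definition quot_boundaries ::
  "('v \<times> 'v) set \<Rightarrow> 'v set set \<Rightarrow> 'v set set \<Rightarrow> int \<Rightarrow> 'v chain set set" where
  "quot_boundaries r X Y d = quot_bd r X Y (d + 1) ` carrier (quot_chains X Y (d + 1))"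

definition quot_cycle_group ::
  "('v \<times> 'v) set \<Rightarrow> 'v set set \<Rightarrow> 'v set set \<Rightarrow> int \<Rightarrow> 'v chain set monoid" where
  "quot_cycle_group r X Y d = (quot_chains X Y d)\<lparr>carrier := quot_cycles r X Y d\<rparr>"

definition quot_homology ::
  "('v \<times> 'v) set \<Rightarrow> 'v set set \<Rightarrow> 'v set set \<Rightarrow> int \<Rightarrow> 'v chain set set monoid" where
  "quot_homology r X Y d = quot_cycle_group r X Y d Mod quot_boundaries r X Y d"

definition homology_class ::
  "('v \<times> 'v) set \<Rightarrow> 'v set set \<Rightarrow> 'v set set \<Rightarrow> int \<Rightarrow> 'v chain \<Rightarrow> 'v chain set set" where
  "homology_class r X Y d c =
     quot_boundaries r X Y d #>\<^bsub>quot_cycle_group r X Y d\<^esub> quot_class X Y d c"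

lemma bd_in_chains:
  assumes "\<And>F G. F \<in> X \<Longrightarrow> G \<subseteq> F \<Longrightarrow> G \<in> X" and "c \<in> carrier (chains X d)"
  shows "bd r c \<in> carrier (chains X (d - 1))"
proof -
  have F: "bd r (frag_of F) \<in> carrier (chains X (d - 1))" if "F \<in> faces X d" for F
  proof -
    have "F - {v} \<in> faces X (d - 1)" if "v \<in> F" for v
    proof -
      have "0 < card F" "int (card F) = d + 1" "finite F" "F \<in> X"
        using \<open>F \<in> faces X d\<close> \<open>v \<in> F\<close> by (auto simp: faces_def card_gt_0_iff)
      moreover have "F - {v} \<in> X"
        using assms(1)[OF \<open>F \<in> X\<close>] by blast
      moreover have "int (card (F - {v})) = int (card F) - 1"
        using \<open>v \<in> F\<close> \<open>0 < card F\<close> by (simp add: of_nat_diff)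
      ultimately show ?thesis by (simp add: faces_def)
    qed
    then have "frag_cmul n (frag_of (F - {v})) \<in> carrier (chains X (d - 1))" if "v \<in> F" for v n
      using that by (force simp: chains_def)
    then show ?thesis
      by (simp add: bd_def frag_extend_of chains_def del: carrier_free_Abelian_group_iff)
         (rule sum_closed_free_Abelian_group, auto)
  qed
  have "Poly_Mapping.keys c \<subseteq> faces X d"
    using assms(2) by (simp add: chains_def)
  then show ?thesis
  proof (induction c rule: frag_induction)
    case zero
    then show ?case by (simp add: bd_def chains_def)
  next
    case (one F)
    then show ?case by (rule F)
  next
    case (diff a b)
    have "bd r (a - b) = bd r a - bd r b"
      by (simp add: bd_def frag_extend_diff)
    moreover have "Poly_Mapping.keys (bd r a - bd r b) \<subseteq> faces X (d - 1)"
      using diff keys_diff[of "bd r a" "bd r b"] by (auto simp: chains_def)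
    ultimately show ?case by (simp add: chains_def)
  qed
qed

lemma quot_bd_class:
  assumes Y: "\<And>F G. F \<in> Y \<Longrightarrow> G \<subseteq> F \<Longrightarrow> G \<in> Y"
  shows "quot_bd r X Y d (quot_class X Y d c) = quot_class X Y (d - 1) (bd r c)"
proof -
  have *: "quot_class X Y (d - 1) (bd r (y + c)) = quot_class X Y (d - 1) (bd r c)"
    if "y \<in> carrier (chains Y d)" for y
  proof -
    let ?z = "bd r y"
    have z: "Poly_Mapping.keys ?z \<subseteq> faces Y (d - 1)"
      using bd_in_chains[where r = r, OF Y that] by (simp add: chains_def)
    have e: "bd r (y + c) = ?z + bd r c"
      by (simp add: bd_def frag_extend_add)
    have 1: "h + (?z + bd r c) = (h + ?z) + bd r c" for h by (simp add: add.assoc)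
    have 2: "h + bd r c = (h - ?z) + (?z + bd r c)" for h by simp
    have 3: "Poly_Mapping.keys (h + ?z) \<subseteq> faces Y (d - 1)"
      and 4: "Poly_Mapping.keys (h - ?z) \<subseteq> faces Y (d - 1)"
      if "Poly_Mapping.keys h \<subseteq> faces Y (d - 1)" for h
      using z that Poly_Mapping.keys_add[of h ?z] keys_diff[of h ?z] by blast+
    have coset: "quot_class X Y (d - 1) x = {h + x |h. Poly_Mapping.keys h \<subseteq> faces Y (d - 1)}" for x
      by (auto simp: quot_class_def r_coset_def chains_def)
    show ?thesis
      unfolding coset e using 1 2 3 4 by blast
  qed
  have "(\<lambda>a. quot_class X Y (d - 1) (bd r a)) ` quot_class X Y d c
          = {quot_class X Y (d - 1) (bd r c)}"
  proof -
    have "quot_class X Y d c = (\<lambda>y. y + c) ` carrier (chains Y d)"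
      by (auto simp: quot_class_def r_coset_def chains_def)
    moreover have "0 \<in> carrier (chains Y d)" by (simp add: chains_def)
    ultimately show ?thesis using * by (auto simp: image_iff)
  qed
  then show ?thesis by (simp add: quot_bd_def)
qed

section \<open>Bases of abelian groups\<close>

definition abelian_basis :: "('g, 'm) monoid_scheme \<Rightarrow> 'i set \<Rightarrow> ('i \<Rightarrow> 'g) \<Rightarrow> bool" where
  "abelian_basis G I b \<longleftrightarrow>
     comm_group G \<and> b \<in> I \<rightarrow> carrier G \<and>
     (\<forall>x \<in> carrier G. \<exists>!n :: 'i \<Rightarrow>\<^sub>0 int. Poly_Mapping.keys n \<subseteq> I \<and>
        x = finprod G (\<lambda>i. b i [^]\<^bsub>G\<^esub> Poly_Mapping.lookup n i) (Poly_Mapping.keys n))"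

section \<open>Graphs with a given vertex set\<close>

definition edges :: "'a set \<Rightarrow> 'a set set" where
  "edges A = {e. e \<subseteq> A \<and> card e = 2}"

definition connected_graph :: "'a set \<Rightarrow> 'a set set \<Rightarrow> bool" where
  "connected_graph A E \<longleftrightarrow> (\<forall>x\<in>A. \<forall>y\<in>A. (x, y) \<in> {(u, v). {u, v} \<in> E}\<^sup>*)"

definition acyclic_graph :: "'a set set \<Rightarrow> bool" where
  "acyclic_graph E \<longleftrightarrow>
     (\<nexists>vs. length vs \<ge> 3 \<and> distinct vs \<and>
       (\<forall>i < length vs. {vs ! i, vs ! (Suc i mod length vs)} \<in> E))"

definition tree :: "'a set \<Rightarrow> 'a set set \<Rightarrow> bool" where
  "tree A T \<longleftrightarrow> T \<subseteq> edges A \<and> connected_graph A T \<and> acyclic_graph T"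

definition vertex_order :: "'a set set \<Rightarrow> 'a \<Rightarrow> nat" where
  "vertex_order E v = card {e \<in> E. v \<in> e}"

text \<open>
  Trees homeomorphic to a segment with \<open>p\<close> as an endpoint. The one-point tree, whose only vertex
  has order 0, counts as a degenerate segment.
\<close>

definition segment_trees :: "'a set \<Rightarrow> 'a \<Rightarrow> 'a set set set" where
  "segment_trees A p =
     {T. tree A T \<and>
         (A = {p} \<or> (\<forall>v\<in>A. vertex_order T v \<in> {1, 2}) \<and> vertex_order T p = 1)}"

section \<open>The complex of connected graphs\<close>

definition Delta :: "'a set \<Rightarrow> 'a set set set" where
  "Delta A = Pow (edges A)"

definition Mcomplex :: "'a set \<Rightarrow> 'a set set set" where
  "Mcomplex A = {E \<in> Delta A. \<not> connected_graph A E}"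

abbreviation K_cycles :: "('a set \<times> 'a set) set \<Rightarrow> 'a set \<Rightarrow> int \<Rightarrow> 'a set chain set set" where
  "K_cycles r A d \<equiv> quot_cycles r (Delta A) (Mcomplex A) d"

abbreviation K_class :: "'a set \<Rightarrow> int \<Rightarrow> 'a set chain \<Rightarrow> 'a set chain set" where
  "K_class A d c \<equiv> quot_class (Delta A) (Mcomplex A) d c"

abbreviation H_K :: "('a set \<times> 'a set) set \<Rightarrow> 'a set \<Rightarrow> int \<Rightarrow> 'a set chain set set monoid" where
  "H_K r A d \<equiv> quot_homology r (Delta A) (Mcomplex A) d"

abbreviation H_K_class ::
  "('a set \<times> 'a set) set \<Rightarrow> 'a set \<Rightarrow> int \<Rightarrow> 'a set chain \<Rightarrow> 'a set chain set set" where
  "H_K_class r A d c \<equiv> homology_class r (Delta A) (Mcomplex A) d c"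

end

theory Submission
  imports Defs "HOL-Combinatorics.Multiset_Permutations"
begin

text \<open>
  A connected graph on \<open>k\<close> vertices has at least \<open>k - 1\<close> edges, so \<open>K(A)\<close> starts in dimension
  \<open>k - 2\<close>, where every chain is a cycle, and the homology there is the group generated by the trees
  modulo the boundaries of connected graphs with \<open>k\<close> edges.

  The segments span: root a tree at \<open>p\<close> and follow it up to its first branch point \<open>z\<close>, with two
  further neighbours \<open>a\<close> and \<open>b\<close>. The boundary of the tree together with the edge \<open>ab\<close> expresses it,
  up to signs, by the trees in which \<open>za\<close> or \<open>zb\<close> has been exchanged for \<open>ab\<close>. Both have fewer
  branches at \<open>z\<close>.

  The segments are independent: number the vertices along a segment \<open>xs\<close> and colour each edge by its
  larger end. The cochain that sends a set of edges with distinct colours to the sign of the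
  permutation sorting it by colour, and all other sets to 0, vanishes on disconnected graphs and on
  boundaries, and the only segment from \<open>p\<close> on which it does not vanish is \<open>xs\<close>.
\<close>

section \<open>Bases of relative homology in the lowest dimension\<close>

lemma bd_diff: "bd r (a - b) = bd r a - bd r b"
  by (simp add: bd_def frag_extend_diff)

lemma bd_add: "bd r (a + b) = bd r a + bd r b"
  by (simp add: bd_def frag_extend_add)

lemma bd_zero: "bd r 0 = 0"
  by (simp add: bd_def)

lemma carrier_chains: "c \<in> carrier (chains X d) \<longleftrightarrow> Poly_Mapping.keys c \<subseteq> faces X d"
  by (simp add: chains_def)

text \<open>These chains represent zero in relative homology once every \<open>d\<close>-chain is a
  relative cycle. \<open>homology_class_eq_iff\<close> thereby reduces equality of cosets of cosets
  to membership in a set of chains.\<close>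

definition null_chains ::
  "('v \<times> 'v) set \<Rightarrow> 'v set set \<Rightarrow> 'v set set \<Rightarrow> int \<Rightarrow> 'v chain set" where
  "null_chains r X Y d =
     {m + bd r u |m u. m \<in> carrier (chains Y d) \<and> u \<in> carrier (chains X (d + 1))}"

lemma null_chains_zero: "0 \<in> null_chains r X Y d"
  by (auto simp: null_chains_def carrier_chains bd_zero
      intro!: exI[of _ 0])

lemma null_chains_diff:
  assumes "x \<in> null_chains r X Y d" "y \<in> null_chains r X Y d"
  shows "x - y \<in> null_chains r X Y d"
proof -
  obtain m u m' u' where
    "x = m + bd r u" "m \<in> carrier (chains Y d)" "u \<in> carrier (chains X (d + 1))"
    "y = m' + bd r u'" "m' \<in> carrier (chains Y d)" "u' \<in> carrier (chains X (d + 1))"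
    using assms by (auto simp: null_chains_def)
  moreover from this have "x - y = (m - m') + bd r (u - u')"
    by (simp add: bd_diff)
  moreover have "m - m' \<in> carrier (chains Y d)" "u - u' \<in> carrier (chains X (d + 1))"
    using calculation keys_diff[of m m'] keys_diff[of u u'] unfolding carrier_chains by blast+
  ultimately show ?thesis
    unfolding null_chains_def by blast
qed

text \<open>The condition \<open>lower_faces\<close> says that the relative complex vanishes in
  dimension \<open>d - 1\<close>, so that only boundaries have to be understood in dimension
  \<open>d\<close>.\<close>

locale complex_pair =
  fixes r :: "('v \<times> 'v) set" and X Y :: "'v set set" and d :: int
  assumes X_closed: "\<And>F G. F \<in> X \<Longrightarrow> G \<subseteq> F \<Longrightarrow> G \<in> X"
    and Y_closed: "\<And>F G. F \<in> Y \<Longrightarrow> G \<subseteq> F \<Longrightarrow> G \<in> Y"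
    and Y_sub: "Y \<subseteq> X"
    and lower_faces: "faces X (d - 1) \<subseteq> Y"
begin

section \<open>Relative chains as cosets\<close>

lemma comm_group_chains: "comm_group (chains Z e)"
  by (simp add: chains_def abelian_free_Abelian_group)

lemma subgroup_chains: "subgroup (carrier (chains Y e)) (chains X e)"
proof -
  have "faces Y e \<subseteq> faces X e"
    using Y_sub by (auto simp: faces_def)
  then have "carrier (chains Y e) \<subseteq> carrier (chains X e)"
    by (auto simp: chains_def)
  moreover have "inv\<^bsub>chains X e\<^esub> a \<in> carrier (chains Y e)" if "a \<in> carrier (chains Y e)" for a
    using that \<open>faces Y e \<subseteq> faces X e\<close> by (auto simp: chains_def)
  moreover have "a + b \<in> carrier (chains Y e)"
    if "a \<in> carrier (chains Y e)" "b \<in> carrier (chains Y e)" for a b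
    using that Poly_Mapping.keys_add[of a b] by (auto simp: chains_def)
  ultimately show ?thesis
    by unfold_locales (auto simp: chains_def)
qed

lemma normal_chains: "carrier (chains Y e) \<lhd> chains X e"
  using comm_group.subgroup_imp_normal[OF comm_group_chains subgroup_chains] .

lemma comm_group_quot: "comm_group (quot_chains X Y e)"
  unfolding quot_chains_def
  by (rule comm_group.abelian_FactGroup[OF comm_group_chains subgroup_chains])

lemma quot_class_hom: "quot_class X Y e \<in> hom (chains X e) (quot_chains X Y e)"
  using normal.r_coset_hom_Mod[OF normal_chains, of e]
  unfolding quot_chains_def quot_class_def[abs_def] .

lemma carrier_quot_chains: "carrier (quot_chains X Y e) = quot_class X Y e ` carrier (chains X e)"
  by (auto simp: quot_chains_def FactGroup_def RCOSETS_def quot_class_def)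

lemma quot_class_eq_iff:
  assumes "a \<in> carrier (chains X e)" "b \<in> carrier (chains X e)"
  shows "quot_class X Y e a = quot_class X Y e b \<longleftrightarrow> a - b \<in> carrier (chains Y e)"
proof
  assume "quot_class X Y e a = quot_class X Y e b"
  moreover have "a \<in> quot_class X Y e a"
    using group.rcos_self[OF comm_group.axioms(2)[OF comm_group_chains] assms(1) subgroup_chains]
    by (simp add: quot_class_def)
  ultimately show "a - b \<in> carrier (chains Y e)"
    by (auto simp: quot_class_def r_coset_def chains_def)
next
  assume *: "a - b \<in> carrier (chains Y e)"
  have "a \<in> quot_class X Y e b"
    using * by (auto simp: quot_class_def r_coset_def chains_def intro!: bexI[of _ "a - b"])
  then show "quot_class X Y e a = quot_class X Y e b"
    unfolding quot_class_def
    using group.repr_independence[OF comm_group.axioms(2)[OF comm_group_chains] _ assms(2)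
        subgroup_chains] by metis
qed

lemma quot_bd_quot_class:
  "quot_bd r X Y e (quot_class X Y e c) = quot_class X Y (e - 1) (bd r c)"
  by (rule quot_bd_class[OF Y_closed])

text \<open>By \<open>lower_faces\<close> the boundary of a \<open>d\<close>-chain of
  \<open>X\<close> is already a chain of \<open>Y\<close>, hence trivial in the quotient.\<close>

lemma quot_cycles_eq: "quot_cycles r X Y d = carrier (quot_chains X Y d)"
proof -
  have "quot_bd r X Y d Q = \<one>\<^bsub>quot_chains X Y (d - 1)\<^esub>"
    if Q: "Q \<in> carrier (quot_chains X Y d)" for Q
  proof -
    obtain c where c: "c \<in> carrier (chains X d)" "Q = quot_class X Y d c"
      using Q by (auto simp: carrier_quot_chains)
    have *: "bd r c \<in> carrier (chains X (d - 1))"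
      by (rule bd_in_chains[OF X_closed c(1)])
    have z: "0 \<in> carrier (chains X (d - 1))"
      by (simp add: carrier_chains)
    have "bd r c - 0 \<in> carrier (chains Y (d - 1))"
      using * lower_faces by (auto simp: carrier_chains faces_def)
    then have "quot_class X Y (d - 1) (bd r c) = quot_class X Y (d - 1) 0"
      using quot_class_eq_iff[OF * z] by blast
    also have "\<dots> = \<one>\<^bsub>quot_chains X Y (d - 1)\<^esub>"
      using hom_one[OF quot_class_hom] comm_group_chains comm_group_quot
      by (metis chains_def comm_group.axioms(2) one_free_Abelian_group)
    finally show ?thesis
      unfolding c(2) quot_bd_quot_class .
  qed
  then show ?thesis
    by (auto simp: quot_cycles_def kernel_def)
qed

lemma quot_cycle_group_eq: "quot_cycle_group r X Y d = quot_chains X Y d"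
  by (simp add: quot_cycle_group_def quot_cycles_eq)

section \<open>Boundaries and homology classes\<close>

lemma bd_hom: "bd r \<in> hom (chains X (d + 1)) (chains X d)"
  using bd_in_chains[where r = r and X = X and d = "d + 1", OF X_closed]
  by (intro homI) (simp_all add: chains_def bd_add)

lemma quot_boundaries_eq:
  "quot_boundaries r X Y d = (quot_class X Y d \<circ> bd r) ` carrier (chains X (d + 1))"
  by (simp add: quot_bd_quot_class quot_boundaries_def carrier_quot_chains image_comp comp_def)

lemma subgroup_boundaries: "subgroup (quot_boundaries r X Y d) (quot_chains X Y d)"
proof -
  have "quot_class X Y d \<circ> bd r \<in> hom (chains X (d + 1)) (quot_chains X Y d)"
    using hom_compose[OF bd_hom quot_class_hom] .
  then have "group_hom (chains X (d + 1)) (quot_chains X Y d) (quot_class X Y d \<circ> bd r)"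
    using comm_group.axioms(2)[OF comm_group_chains] comm_group.axioms(2)[OF comm_group_quot]
    by (simp add: group_hom_def group_hom_axioms_def)
  then show ?thesis
    unfolding quot_boundaries_eq by (rule group_hom.img_is_subgroup)
qed

lemma comm_group_homology: "comm_group (quot_homology r X Y d)"
  unfolding quot_homology_def quot_cycle_group_eq
  by (rule comm_group.abelian_FactGroup[OF comm_group_quot subgroup_boundaries])

lemma homology_class_hom: "homology_class r X Y d \<in> hom (chains X d) (quot_homology r X Y d)"
proof -
  have "quot_boundaries r X Y d \<lhd> quot_chains X Y d"
    by (rule comm_group.subgroup_imp_normal[OF comm_group_quot subgroup_boundaries])
  then have "(#>\<^bsub>quot_chains X Y d\<^esub>) (quot_boundaries r X Y d)
      \<in> hom (quot_chains X Y d) (quot_homology r X Y d)"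
    unfolding quot_homology_def quot_cycle_group_eq by (rule normal.r_coset_hom_Mod)
  then show ?thesis
    using hom_compose[OF quot_class_hom]
    unfolding homology_class_def[abs_def] quot_cycle_group_eq comp_def by fast
qed

lemma carrier_homology: "carrier (quot_homology r X Y d) = homology_class r X Y d ` carrier (chains X d)"
  by (auto simp: quot_homology_def FactGroup_def RCOSETS_def homology_class_def
      quot_cycle_group_eq carrier_quot_chains)

lemma homology_class_eq_iff:
  assumes a: "a \<in> carrier (chains X d)" and b: "b \<in> carrier (chains X d)"
  shows "homology_class r X Y d a = homology_class r X Y d b \<longleftrightarrow> a - b \<in> null_chains r X Y d"
proof -
  let ?Q = "quot_chains X Y d" and ?B = "quot_boundaries r X Y d" and ?q = "quot_class X Y d"
  interpret Q: comm_group ?Q by (rule comm_group_quot)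
  have qa: "?q a \<in> carrier ?Q" and qb: "?q b \<in> carrier ?Q"
    using a b by (auto simp: carrier_quot_chains)
  \<comment> \<open>Two layers of cosets are removed in turn: first the one by boundaries, then the
    one by chains of \<open>Y\<close>.\<close>
  have "homology_class r X Y d a = homology_class r X Y d b \<longleftrightarrow> ?q a \<in> ?B #>\<^bsub>?Q\<^esub> ?q b"
    unfolding homology_class_def quot_cycle_group_eq
    using Q.repr_independence[OF _ qb subgroup_boundaries] Q.rcos_self[OF qa subgroup_boundaries]
    by metis
  also have "\<dots> \<longleftrightarrow> (\<exists>u\<in>carrier (chains X (d + 1)). ?q a = ?q (bd r u + b))"
  proof -
    have "?q (bd r u) \<otimes>\<^bsub>?Q\<^esub> ?q b = ?q (bd r u + b)" if "u \<in> carrier (chains X (d + 1))" for u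
      using hom_mult[OF quot_class_hom hom_in_carrier[OF bd_hom that] b]
      by (simp add: chains_def)
    then show ?thesis
      by (auto simp: r_coset_def quot_boundaries_eq)
  qed
  also have "\<dots> \<longleftrightarrow> (\<exists>u\<in>carrier (chains X (d + 1)). a - (bd r u + b) \<in> carrier (chains Y d))"
  proof (rule bex_cong[OF refl])
    fix u assume u: "u \<in> carrier (chains X (d + 1))"
    have "bd r u + b \<in> carrier (chains X d)"
      using hom_in_carrier[OF bd_hom u] b Poly_Mapping.keys_add[of "bd r u" b]
      unfolding carrier_chains by blast
    then show "?q a = ?q (bd r u + b) \<longleftrightarrow> a - (bd r u + b) \<in> carrier (chains Y d)"
      by (rule quot_class_eq_iff[OF a])
  qed
  also have "\<dots> \<longleftrightarrow> a - b \<in> null_chains r X Y d"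
  proof -
    have "a - (bd r u + b) = m \<longleftrightarrow> a - b = m + bd r u" for u m
      by (auto simp: algebra_simps)
    then show ?thesis
      unfolding null_chains_def mem_Collect_eq by metis
  qed
  finally show ?thesis .
qed

text \<open>Since a set \<open>I\<close> of faces indexes its own candidate basis, a coefficient function on \<open>I\<close> is
  itself a chain; no separate index type is needed.\<close>

lemma abelian_basis_homologyI:
  assumes I: "I \<subseteq> faces X d"
    and s: "\<And>i. i \<in> I \<Longrightarrow> s i = 1 \<or> s i = -1"
    and span: "\<And>c. c \<in> carrier (chains X d) \<Longrightarrow>
        \<exists>n. Poly_Mapping.keys n \<subseteq> I \<and> c - n \<in> null_chains r X Y d"
    and indep: "\<And>n. Poly_Mapping.keys n \<subseteq> I \<Longrightarrow> n \<in> null_chains r X Y d \<Longrightarrow> n = 0"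
  shows "abelian_basis (quot_homology r X Y d) I
    (\<lambda>i. homology_class r X Y d (frag_cmul (s i) (frag_of i)))"
proof -
  let ?H = "quot_homology r X Y d" and ?h = "homology_class r X Y d" and ?C = "chains X d"
  interpret H: comm_group ?H by (rule comm_group_homology)
  interpret C: comm_group ?C by (rule comm_group_chains)
  interpret h: group_hom ?C ?H ?h
    by unfold_locales (rule homology_class_hom)
  define b where "b i = frag_cmul (s i) (frag_of i)" for i
  \<comment> \<open>\<open>tw\<close> multiplies each coefficient by its orientation sign. As the
    signs on \<open>I\<close> are 1 or -1, it is an involution on chains supported in
    \<open>I\<close>, which moves coefficients between signed and unsigned generators.\<close>
  define tw where "tw n = frag_extend b n" for n
  have b: "b i \<in> carrier ?C" if "i \<in> I" for i
    using I that by (auto simp: b_def carrier_chains split: if_splits)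
  \<comment> \<open>Membership of the sum in the carrier is carried along because the homomorphism
    law needs it for the partial sum in the induction step.\<close>
  have prod: "finprod ?H (\<lambda>i. ?h (b i) [^]\<^bsub>?H\<^esub> (f i :: int)) J = ?h (\<Sum>i\<in>J. frag_cmul (f i) (b i))
      \<and> (\<Sum>i\<in>J. frag_cmul (f i) (b i)) \<in> carrier ?C" if "finite J" "J \<subseteq> I" for f J
    using that
  proof (induction J rule: finite_induct)
    case empty
    then show ?case
      using h.hom_one by (simp add: chains_def)
  next
    case (insert j J)
    have bj: "frag_cmul (f j) (b j) \<in> carrier ?C"
      using b[of j] insert.prems keys_cmul[of "f j" "b j"] unfolding carrier_chains by blast
    have "?h (b j) [^]\<^bsub>?H\<^esub> f j = ?h (frag_cmul (f j) (b j))"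
      using h.hom_int_pow[of "b j" "f j"] b[of j] insert.prems
      by (simp add: chains_def)
    moreover have "(\<lambda>i. ?h (b i) [^]\<^bsub>?H\<^esub> f i) \<in> J \<rightarrow> carrier ?H" "?h (b j) [^]\<^bsub>?H\<^esub> f j \<in> carrier ?H"
      using b insert.prems by auto
    ultimately show ?case
      using insert bj h.hom_mult[OF bj, of "\<Sum>i\<in>J. frag_cmul (f i) (b i)"]
        C.m_closed[OF bj, of "\<Sum>i\<in>J. frag_cmul (f i) (b i)"]
      by (simp add: chains_def)
  qed
  have comb: "finprod ?H (\<lambda>i. ?h (b i) [^]\<^bsub>?H\<^esub> Poly_Mapping.lookup n i) (Poly_Mapping.keys n) = ?h (tw n)"
    and tw_carrier: "tw n \<in> carrier ?C" if "Poly_Mapping.keys n \<subseteq> I" for n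
    using prod[of "Poly_Mapping.keys n" "Poly_Mapping.lookup n"] that
    by (simp_all add: tw_def frag_extend_def)
  have tw_lookup: "Poly_Mapping.lookup (tw n) i = s i * Poly_Mapping.lookup n i" for n i
  proof -
    have "Poly_Mapping.lookup (tw n) i
        = (\<Sum>j\<in>Poly_Mapping.keys n. if j = i then Poly_Mapping.lookup n j * s j else 0)"
      unfolding tw_def frag_extend_def lookup_sum
      by (rule sum.cong) (auto simp: b_def lookup_single when_def)
    then show ?thesis
      by (simp add: sum.delta in_keys_iff)
  qed
  have tw_keys: "Poly_Mapping.keys (tw n) \<subseteq> Poly_Mapping.keys n" for n
    using tw_lookup[of n] by (auto simp: in_keys_iff)
  have tw_tw: "tw (tw n) = n" if "Poly_Mapping.keys n \<subseteq> I" for n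
  proof (rule poly_mapping_eqI)
    fix i
    show "Poly_Mapping.lookup (tw (tw n)) i = Poly_Mapping.lookup n i"
      using s[of i] that by (cases "i \<in> I") (auto simp: tw_lookup in_keys_iff)
  qed
  have "\<exists>!n :: 'v set \<Rightarrow>\<^sub>0 int. Poly_Mapping.keys n \<subseteq> I \<and>
      x = finprod ?H (\<lambda>i. ?h (b i) [^]\<^bsub>?H\<^esub> Poly_Mapping.lookup n i) (Poly_Mapping.keys n)"
    if x: "x \<in> carrier ?H" for x
  proof -
    obtain c where c: "c \<in> carrier ?C" "x = ?h c"
      using x by (auto simp: carrier_homology)
    obtain m where m: "Poly_Mapping.keys m \<subseteq> I" "c - m \<in> null_chains r X Y d"
      using span[OF c(1)] by blast
    have mC: "m \<in> carrier ?C"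
      using m I by (auto simp: carrier_chains)
    have k: "Poly_Mapping.keys (tw m) \<subseteq> I"
      using tw_keys m by blast
    \<comment> \<open>The coefficients \<open>m\<close> are twisted to cancel the signs of the
      generators: the resulting product is \<open>?h (tw (tw m))\<close>, which is
      \<open>?h m\<close>.\<close>
    show ?thesis
    proof (rule ex1I[where a = "tw m"], rule conjI[OF k], goal_cases)
      case 1
      show "x = finprod ?H (\<lambda>i. ?h (b i) [^]\<^bsub>?H\<^esub> Poly_Mapping.lookup (tw m) i)
          (Poly_Mapping.keys (tw m))"
        using comb[OF k] tw_tw[OF m(1)] homology_class_eq_iff[OF c(1) mC] m(2) c(2) by simp
    next
      case (2 n)
      then have n: "Poly_Mapping.keys n \<subseteq> I"
        "x = finprod ?H (\<lambda>i. ?h (b i) [^]\<^bsub>?H\<^esub> Poly_Mapping.lookup n i) (Poly_Mapping.keys n)"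
        by auto
      have "c - tw n \<in> null_chains r X Y d"
        using n comb[OF n(1)] c(2) homology_class_eq_iff[OF c(1) tw_carrier[OF n(1)]] by simp
      \<comment> \<open>This difference is \<open>m - tw n\<close>, a null chain supported in
        \<open>I\<close>.\<close>
      then have "(c - tw n) - (c - m) \<in> null_chains r X Y d"
        using m(2) by (rule null_chains_diff)
      moreover have "Poly_Mapping.keys ((c - tw n) - (c - m)) \<subseteq> I"
        using keys_diff[of m "tw n"] m(1) n(1) tw_keys[of n] by auto
      ultimately have "(c - tw n) - (c - m) = 0"
        using indep by blast
      then show "n = tw m"
        using tw_tw[OF n(1)] by simp
    qed
  qed
  then show ?thesis
    using b comm_group_homology unfolding abelian_basis_def b_def by auto
qed

end

section \<open>Trees\<close>

text \<open>Trees built from a root by attaching leaves. This supplies an induction principle that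
  the conditions connected and acyclic do not give directly; \<open>tree_iff_grown\<close> relates
  the two notions.\<close>

inductive grown :: "'a \<Rightarrow> 'a set \<Rightarrow> 'a set set \<Rightarrow> bool" for p where
  root: "grown p {p} {}"
| leaf: "grown p S T \<Longrightarrow> x \<in> S \<Longrightarrow> y \<notin> S \<Longrightarrow> grown p (insert y S) (insert {x, y} T)"

lemma in_edgesE:
  assumes "e \<in> edges A"
  obtains u v where "e = {u, v}" "u \<noteq> v" "u \<in> A" "v \<in> A"
  using assms by (auto simp: edges_def card_2_iff)

lemma in_edges_pair [simp]: "{u, v} \<in> edges A \<longleftrightarrow> u \<in> A \<and> v \<in> A \<and> u \<noteq> v"
  by (auto simp: edges_def card_2_iff doubleton_eq_iff)

lemma finite_edges: "finite A \<Longrightarrow> finite (edges A)"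
  by (rule finite_subset[of _ "Pow A"]) (auto simp: edges_def)

lemma edges_mono: "A \<subseteq> B \<Longrightarrow> edges A \<subseteq> edges B"
  by (auto simp: edges_def)

lemma grown_basic:
  assumes "grown p S T"
  shows "finite S" "p \<in> S" "finite T" "T \<subseteq> edges S" "Suc (card T) = card S"
proof -
  have "finite S \<and> p \<in> S \<and> finite T \<and> T \<subseteq> edges S \<and> Suc (card T) = card S"
    using assms
  proof induction
    case root
    then show ?case by simp
  next
    case (leaf S T x y)
    have "{x, y} \<notin> T"
      using leaf by (auto dest: subsetD)
    then show ?case
      using leaf edges_mono[of S "insert y S"] by auto
  qed
  then show "finite S" "p \<in> S" "finite T" "T \<subseteq> edges S" "Suc (card T) = card S"
    by auto
qed

lemma connected_graph_mono: "connected_graph A E \<Longrightarrow> E \<subseteq> F \<Longrightarrow> connected_graph A F"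
  using rtrancl_mono[of "{(u, v). {u, v} \<in> E}" "{(u, v). {u, v} \<in> F}"]
  unfolding connected_graph_def by blast

lemma connected_graph_rootI:
  assumes "\<And>x. x \<in> A \<Longrightarrow> (p, x) \<in> {(u, v). {u, v} \<in> E}\<^sup>*"
  shows "connected_graph A E"
proof -
  have "sym {(u, v). {u, v} \<in> E}"
    by (auto simp: sym_def insert_commute)
  then have "(x, p) \<in> {(u, v). {u, v} \<in> E}\<^sup>*" if "x \<in> A" for x
    using assms[OF that] by (blast dest: sym_rtrancl symD)
  then show ?thesis
    using assms unfolding connected_graph_def by (blast intro: rtrancl_trans)
qed

lemma grown_connected:
  assumes "grown p S T"
  shows "connected_graph S T"
proof (rule connected_graph_rootI)
  show "(p, x) \<in> {(u, v). {u, v} \<in> T}\<^sup>*" if "x \<in> S" for x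
    using assms that
  proof (induction arbitrary: x)
    case root
    then show ?case by simp
  next
    case (leaf S T x y z)
    have sub: "{(u, v). {u, v} \<in> T}\<^sup>* \<subseteq> {(u, v). {u, v} \<in> insert {x, y} T}\<^sup>*"
      by (rule rtrancl_mono) auto
    have "(p, x) \<in> {(u, v). {u, v} \<in> insert {x, y} T}\<^sup>*"
      using leaf sub by blast
    then have "(p, y) \<in> {(u, v). {u, v} \<in> insert {x, y} T}\<^sup>*"
      by (rule rtrancl.rtrancl_into_rtrancl) simp
    then show ?case
      using leaf sub by blast
  qed
qed

text \<open>A cycle through the new leaf would need two different edges there, but
  \<open>{x, y}\<close> is the only one; a cycle avoiding the leaf lies in \<open>T\<close>.\<close>

lemma grown_acyclic:
  assumes "grown p S T"
  shows "acyclic_graph T"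
  using assms
proof induction
  case root
  then show ?case by (auto simp: acyclic_graph_def intro!: exI[of _ 0])
next
  case (leaf S T x y)
  show ?case
    unfolding acyclic_graph_def
  proof
    assume "\<exists>vs. 3 \<le> length vs \<and> distinct vs \<and>
      (\<forall>i<length vs. {vs ! i, vs ! (Suc i mod length vs)} \<in> insert {x, y} T)"
    then obtain vs where vs: "3 \<le> length vs" "distinct vs"
      "\<And>i. i < length vs \<Longrightarrow> {vs ! i, vs ! (Suc i mod length vs)} \<in> insert {x, y} T"
      by blast
    have y: "e = {x, y}" if "e \<in> insert {x, y} T" "y \<in> e" for e
      using that leaf grown_basic(4)[OF leaf.hyps(1)] by (auto simp: edges_def)
    show False
    proof (cases "y \<in> set vs")
      case False
      have "{vs ! i, vs ! (Suc i mod length vs)} \<in> T" if "i < length vs" for i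
      proof -
        have "Suc i mod length vs < length vs"
          using that by (intro mod_less_divisor) linarith
        then have "{vs ! i, vs ! (Suc i mod length vs)} \<noteq> {x, y}"
          using False that nth_mem by (metis insertI1 insert_iff singletonD)
        then show ?thesis
          using vs(3)[OF that] by blast
      qed
      then show False
        using leaf.IH vs(1,2) unfolding acyclic_graph_def by blast
    next
      case True
      then obtain j where j: "j < length vs" "vs ! j = y"
        by (auto simp: in_set_conv_nth)
      \<comment> \<open>\<open>l\<close> and \<open>m\<close> are the positions before and after
        \<open>j\<close> around the cycle. They differ because the cycle has at least three
        vertices.\<close>
      define l where "l = (if j = 0 then length vs - 1 else j - 1)"
      have l: "l < length vs" "Suc l mod length vs = j"
        using j by (auto simp: l_def)
      define m where "m = Suc j mod length vs"
      have m: "m < length vs" "m \<noteq> l" "m \<noteq> j" "l \<noteq> j"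
        using j vs(1) by (auto simp: l_def m_def mod_Suc)
      have "{y, vs ! m} = {x, y}"
        using y[OF vs(3)[OF j(1)]] j by (auto simp: m_def)
      moreover have "{vs ! l, y} = {x, y}"
        using y[OF vs(3)[OF l(1)]] l j by auto
      ultimately have "vs ! m = vs ! l"
        by (metis doubleton_eq_iff)
      then show False
        using m l vs(2) nth_eq_iff_index_eq by blast
    qed
  qed
qed

lemma grown_is_tree: "grown p A T \<Longrightarrow> tree A T"
  by (simp add: tree_def grown_basic(4) grown_connected grown_acyclic)

text \<open>Without such an edge \<open>S\<close> would be closed under steps in \<open>E\<close>,
  and nothing outside it could be reached from \<open>p\<close>.\<close>

lemma connected_graph_crossing:
  assumes "connected_graph A E" "E \<subseteq> edges A" "p \<in> S" "S \<subset> A"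
  obtains x y where "x \<in> S" "y \<in> A" "y \<notin> S" "{x, y} \<in> E"
proof (rule ccontr)
  note witness = that
  assume no: "\<not> thesis"
  have "z \<in> S" if "(p, z) \<in> {(u, v). {u, v} \<in> E}\<^sup>*" for z
    using that
  proof induction
    case base
    then show ?case using assms by simp
  next
    case (step y z)
    then have "{y, z} \<in> E" "z \<in> A"
      using assms(2) by auto
    then show ?case
      using witness no step.IH by blast
  qed
  moreover obtain z where "z \<in> A" "z \<notin> S"
    using assms(4) by blast
  ultimately show False
    using assms unfolding connected_graph_def by blast
qed

text \<open>A spanning tree is built greedily: while some vertex is missing, a crossing edge
  attaches one more leaf.\<close>

lemma connected_graph_contains_grown:
  assumes "finite A" "p \<in> A" "connected_graph A E" "E \<subseteq> edges A"
  obtains T where "T \<subseteq> E" "grown p A T"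
proof -
  have "\<exists>S T. S \<subseteq> A \<and> card S = Suc n \<and> T \<subseteq> E \<and> grown p S T" if "n < card A" for n
    using that
  proof (induction n)
    case 0
    show ?case
      using assms grown.root[of p] by (intro exI[of _ "{p}"] exI[of _ "{}"]) auto
  next
    case (Suc n)
    then obtain S T where ST: "S \<subseteq> A" "card S = Suc n" "T \<subseteq> E" "grown p S T"
      by auto
    then have "S \<subset> A"
      using Suc.prems by auto
    then obtain x y where xy: "x \<in> S" "y \<in> A" "y \<notin> S" "{x, y} \<in> E"
      using connected_graph_crossing[OF assms(3,4) grown_basic(2)[OF ST(4)]] by metis
    have "finite S"
      by (rule grown_basic(1)[OF ST(4)])
    then show ?case
      using ST xy grown.leaf[OF ST(4) xy(1,3)]
      by (intro exI[of _ "insert y S"] exI[of _ "insert {x, y} T"]) auto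
  qed
  moreover have "card A > 0"
    using assms card_gt_0_iff by blast
  ultimately obtain S T where ST: "S \<subseteq> A" "card S = card A" "T \<subseteq> E" "grown p S T"
    by (metis Suc_pred' lessI)
  then have "S = A"
    using assms(1) card_subset_eq by blast
  then show ?thesis
    using that ST by blast
qed

lemma card_connected_graph:
  assumes "finite A" "A \<noteq> {}" "connected_graph A E" "E \<subseteq> edges A"
  shows "card A \<le> Suc (card E)"
proof -
  obtain p where "p \<in> A"
    using assms by blast
  then obtain T where T: "T \<subseteq> E" "grown p A T"
    using connected_graph_contains_grown assms by metis
  moreover have "finite E"
    using assms finite_edges finite_subset by metis
  ultimately show ?thesis
    using grown_basic(5)[OF T(2)] card_mono[of E T] by linarith
qed

section \<open>Paths as lists of vertices\<close>

definition path_edges :: "'a list \<Rightarrow> 'a set set" where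
  "path_edges xs = {{xs ! i, xs ! Suc i} |i. Suc i < length xs}"

lemma path_edges_singleton [simp]: "path_edges [x] = {}"
  by (simp add: path_edges_def)

lemma path_edges_snoc:
  assumes "xs \<noteq> []"
  shows "path_edges (xs @ [y]) = insert {last xs, y} (path_edges xs)" (is "?L = ?R")
proof
  show "?L \<subseteq> ?R"
  proof
    fix e assume "e \<in> ?L"
    then obtain i where i: "e = {(xs @ [y]) ! i, (xs @ [y]) ! Suc i}" "Suc i < Suc (length xs)"
      by (auto simp: path_edges_def)
    show "e \<in> ?R"
    proof (cases "Suc i < length xs")
      case True
      then show ?thesis
        using i by (auto simp: path_edges_def nth_append)
    next
      case False
      then have "i = length xs - 1" "Suc i = length xs"
        using i assms by auto
      then show ?thesis
        using i assms by (auto simp: nth_append last_conv_nth)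
    qed
  qed
  show "?R \<subseteq> ?L"
  proof
    fix e assume "e \<in> ?R"
    then consider "e = {last xs, y}" | i where "e = {xs ! i, xs ! Suc i}" "Suc i < length xs"
      by (auto simp: path_edges_def)
    then show "e \<in> ?L"
    proof cases
      case 1
      then show ?thesis
        using assms unfolding path_edges_def
        by (auto simp: nth_append last_conv_nth intro!: exI[of _ "length xs - 1"])
    next
      case 2
      then show ?thesis
        unfolding path_edges_def by (auto simp: nth_append intro!: exI[of _ i])
    qed
  qed
qed

lemma path_edges_Cons:
  assumes "xs \<noteq> []"
  shows "path_edges (y # xs) = insert {y, hd xs} (path_edges xs)"
  using assms
proof (induction xs rule: rev_nonempty_induct)
  case (single x)
  then show ?case
    using path_edges_snoc[of "[y]" x] by simp
next
  case (snoc x xs)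
  then show ?case
    using path_edges_snoc[of "y # xs" x] path_edges_snoc[of xs x] by auto
qed

lemma path_edges_subset: "path_edges xs \<subseteq> Pow (set xs)"
  by (auto simp: path_edges_def)

lemma grown_path_edges:
  assumes "xs \<noteq> []" "distinct xs"
  shows "grown (hd xs) (set xs) (path_edges xs)"
  using assms
proof (induction xs rule: rev_nonempty_induct)
  case (single x)
  then show ?case by (simp add: grown.root)
next
  case (snoc x xs)
  then show ?case
    using grown.leaf[of "hd xs" "set xs" "path_edges xs" "last xs" x]
    by (simp add: path_edges_snoc)
qed

lemma grown_path:
  assumes "grown p S T" "u \<in> S" "v \<in> S"
  shows "\<exists>vs. vs \<noteq> [] \<and> distinct vs \<and> hd vs = u \<and> last vs = v \<and> set vs \<subseteq> S \<and> path_edges vs \<subseteq> T"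
  using assms
proof (induction arbitrary: u v)
  case root
  then show ?case by (intro exI[of _ "[p]"]) auto
next
  case (leaf S T x y)
  consider "u = y" "v = y" | "u = y" "v \<in> S" | "u \<in> S" "v = y" | "u \<in> S" "v \<in> S"
    using leaf.prems by blast
  then show ?case
  proof cases
    case 1
    then show ?thesis by (intro exI[of _ "[y]"]) auto
  next
    case 2
    then obtain vs where "vs \<noteq> []" "distinct vs" "hd vs = x" "last vs = v" "set vs \<subseteq> S" "path_edges vs \<subseteq> T"
      using leaf.IH leaf.hyps by meson
    then show ?thesis
      using 2 leaf.hyps by (intro exI[of _ "y # vs"]) (auto simp: path_edges_Cons insert_commute)
  next
    case 3
    then obtain vs where "vs \<noteq> []" "distinct vs" "hd vs = u" "last vs = x" "set vs \<subseteq> S" "path_edges vs \<subseteq> T"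
      using leaf.IH leaf.hyps by meson
    then show ?thesis
      using 3 leaf.hyps by (intro exI[of _ "vs @ [y]"]) (auto simp: path_edges_snoc)
  next
    case 4
    then show ?thesis
      using leaf.IH[OF 4] by blast
  qed
qed

text \<open>A path in \<open>T\<close> between the ends of \<open>e\<close> closes up through
  \<open>e\<close>. It has at least three vertices, since the ends differ and \<open>e\<close> is
  not in \<open>T\<close>.\<close>

lemma grown_insert_cyclic:
  assumes "grown p A T" "e \<in> edges A" "e \<notin> T"
  shows "\<not> acyclic_graph (insert e T)"
proof -
  obtain u v where e: "e = {u, v}" "u \<noteq> v" "u \<in> A" "v \<in> A"
    using assms(2) by (rule in_edgesE)
  obtain vs where vs: "vs \<noteq> []" "distinct vs" "hd vs = u" "last vs = v" "path_edges vs \<subseteq> T"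
    using grown_path[OF assms(1) e(3,4)] by blast
  have "length vs \<noteq> 1"
    using vs(3,4) e(2) by (auto simp: length_Suc_conv)
  moreover have "length vs \<noteq> 2"
  proof
    assume "length vs = 2"
    then have "vs = [u, v]"
      using vs(3,4) by (auto simp: length_Suc_conv numeral_2_eq_2)
    then have "{u, v} \<in> T"
      using vs(5) path_edges_Cons[of "[v]" u] by simp
    then show False
      using e assms(3) by simp
  qed
  ultimately have "length vs \<ge> 3"
    using vs(1) by (cases "length vs") auto
  moreover have "{vs ! i, vs ! (Suc i mod length vs)} \<in> insert e T" if "i < length vs" for i
  proof (cases "Suc i < length vs")
    case True
    then show ?thesis
      using vs(5) by (auto simp: path_edges_def)
  next
    case False
    then have "Suc i = length vs"
      using that by simp
    then have "vs ! i = v" "vs ! (Suc i mod length vs) = u"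
      using vs by (metis diff_Suc_1 last_conv_nth, metis hd_conv_nth mod_self)
    then show ?thesis
      using e by (simp add: insert_commute)
  qed
  ultimately show ?thesis
    using vs(2) unfolding acyclic_graph_def by blast
qed

text \<open>Going from left to right, a grown spanning tree inside \<open>T\<close> already exhausts
  \<open>T\<close>, because any further edge would close a cycle.\<close>

lemma tree_iff_grown:
  assumes "finite A" "p \<in> A"
  shows "tree A T \<longleftrightarrow> grown p A T"
proof
  assume T: "tree A T"
  then obtain T' where T': "T' \<subseteq> T" "grown p A T'"
    using connected_graph_contains_grown[OF assms] by (metis tree_def)
  have "acyclic_graph F" if "F \<subseteq> T" for F
    using T that unfolding tree_def acyclic_graph_def by blast
  then have "T \<subseteq> T'"
    using grown_insert_cyclic[OF T'(2)] T T'(1) unfolding tree_def by blast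
  then show "grown p A T"
    using T' by simp
qed (rule grown_is_tree)

lemma card_tree:
  assumes "finite A" "A \<noteq> {}" "tree A T"
  shows "Suc (card T) = card A"
  using assms tree_iff_grown grown_basic(5) by (metis ex_in_conv)

text \<open>A path \<open>xs\<close> from \<open>p\<close> in \<open>E\<close> along which \<open>E\<close> does not branch before the last vertex.\<close>

definition stem :: "'a \<Rightarrow> 'a set set \<Rightarrow> 'a list \<Rightarrow> bool" where
  "stem p E xs \<longleftrightarrow> xs \<noteq> [] \<and> distinct xs \<and> hd xs = p \<and> path_edges xs \<subseteq> E \<and>
     (\<forall>e\<in>E. e \<inter> set (butlast xs) \<noteq> {} \<longrightarrow> e \<in> path_edges xs)"

lemma stem_root: "stem p E [p]"
  by (simp add: stem_def)

lemma in_set_butlast_iff: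
  "xs \<noteq> [] \<Longrightarrow> distinct xs \<Longrightarrow> x \<in> set (butlast xs) \<longleftrightarrow> x \<in> set xs \<and> x \<noteq> last xs"
  by (cases xs rule: rev_cases) auto

text \<open>An edge leaving the stem cannot start before its last vertex, because all edges at those
  vertices belong to the path itself.\<close>

lemma stem_crossing:
  assumes "connected_graph A E" "E \<subseteq> edges A" "stem p E xs" "set xs \<subset> A"
  obtains y where "y \<in> A" "y \<notin> set xs" "{last xs, y} \<in> E"
proof -
  have "p \<in> set xs"
    using assms(3) by (auto simp: stem_def)
  then obtain x y where xy: "x \<in> set xs" "y \<in> A" "y \<notin> set xs" "{x, y} \<in> E"
    using connected_graph_crossing[OF assms(1,2) _ assms(4)] by metis
  have "{x, y} \<notin> path_edges xs"
    using xy(3) path_edges_subset[of xs] by blast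
  then have "x \<notin> set (butlast xs)"
    using assms(3) xy by (auto simp: stem_def)
  then have "x = last xs"
    using assms(3) xy(1) by (auto simp: stem_def in_set_butlast_iff)
  then show ?thesis
    using that xy by blast
qed

lemma stem_snoc:
  assumes "E \<subseteq> edges A" "stem p E xs" "y \<notin> set xs" "{last xs, y} \<in> E"
    and unique: "\<And>z. z \<notin> set xs \<Longrightarrow> {last xs, z} \<in> E \<Longrightarrow> z = y"
  shows "stem p E (xs @ [y])"
proof -
  have xs: "xs \<noteq> []" "distinct xs"
    using assms(2) by (auto simp: stem_def)
  have "e \<in> path_edges (xs @ [y])" if "e \<in> E" "e \<inter> set xs \<noteq> {}" for e
  proof (cases "e \<inter> set (butlast xs) = {}")
    case False
    then show ?thesis
      using assms(2) that xs by (auto simp: stem_def path_edges_snoc)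
  next
    case True
    then have "last xs \<in> e"
      using that xs by (auto simp: in_set_butlast_iff)
    moreover have "e \<in> edges A"
      using assms(1) that(1) by blast
    then obtain u v where "e = {u, v}" "u \<noteq> v"
      by (rule in_edgesE)
    ultimately obtain z where "e = {last xs, z}" "z \<noteq> last xs"
      by (metis insertE insert_commute singletonD)
    \<comment> \<open>The edge avoids \<open>butlast xs\<close>, and \<open>z\<close> is not
      \<open>last xs\<close>, so its other end is off the stem.\<close>
    moreover have "z \<notin> set xs"
      using calculation True xs by (auto simp: in_set_butlast_iff)
    ultimately show ?thesis
      using that(1) xs(1) unique[of z] by (simp add: path_edges_snoc)
  qed
  then show ?thesis
    using assms(2-4) xs by (auto simp: stem_def path_edges_snoc)
qed

text \<open>An edge has two ends and only one of them can be the last vertex, so every edge touches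
  the unbranched part and lies on the path.\<close>

lemma stem_full:
  assumes "E \<subseteq> edges A" "stem p E xs" "set xs = A"
  shows "E = path_edges xs"
proof
  show "E \<subseteq> path_edges xs"
  proof
    fix e assume e: "e \<in> E"
    then obtain u v where "e = {u, v}" "u \<noteq> v" "u \<in> A" "v \<in> A"
      using in_edgesE[OF subsetD[OF assms(1) e]] by metis
    then have "e \<inter> set (butlast xs) \<noteq> {}"
      using assms(2,3) by (auto simp: stem_def in_set_butlast_iff)
    then show "e \<in> path_edges xs"
      using e assms(2) by (simp add: stem_def)
  qed
qed (use assms in \<open>simp add: stem_def\<close>)

section \<open>Segments\<close>

definition paths_from :: "'a set \<Rightarrow> 'a \<Rightarrow> 'a list set" where
  "paths_from A p = {xs. xs \<noteq> [] \<and> distinct xs \<and> set xs = A \<and> hd xs = p}"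

lemma card_paths_from:
  assumes "finite A" "p \<in> A"
  shows "card (paths_from A p) = fact (card A - 1)"
proof -
  have "paths_from A p = (#) p ` permutations_of_set (A - {p})"
  proof (intro equalityI subsetI)
    fix xs assume "xs \<in> paths_from A p"
    then show "xs \<in> (#) p ` permutations_of_set (A - {p})"
      by (cases xs) (auto simp: paths_from_def permutations_of_set_def)
  next
    fix xs assume "xs \<in> (#) p ` permutations_of_set (A - {p})"
    then obtain ys where "xs = p # ys" "set ys = A - {p}" "distinct ys"
      by (auto simp: permutations_of_set_def)
    then show "xs \<in> paths_from A p"
      using assms(2) by (simp add: paths_from_def insert_absorb)
  qed
  then show ?thesis
    using assms by (simp add: card_image)
qed

lemma edges_at_nth:
  assumes "distinct xs" "j < length xs"
  shows "{e \<in> path_edges xs. xs ! j \<in> e}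
    = (if j = 0 then {} else {{xs ! (j - 1), xs ! j}})
      \<union> (if Suc j < length xs then {{xs ! j, xs ! Suc j}} else {})" (is "?L = ?R")
proof
  show "?L \<subseteq> ?R"
  proof
    fix e assume "e \<in> ?L"
    then obtain i where i: "e = {xs ! i, xs ! Suc i}" "Suc i < length xs" "xs ! j \<in> e"
      by (auto simp: path_edges_def)
    then have "j = i \<or> j = Suc i"
      using assms by (auto simp: nth_eq_iff_index_eq)
    then show "e \<in> ?R"
      using i by auto
  qed
  have "{xs ! (j - 1), xs ! j} \<in> path_edges xs" if "j \<noteq> 0"
    using that assms(2) unfolding path_edges_def by (auto intro!: exI[of _ "j - 1"])
  then show "?R \<subseteq> ?L"
    by (auto simp: path_edges_def)
qed

lemma vertex_order_nth:
  assumes "distinct xs" "j < length xs"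
  shows "vertex_order (path_edges xs) (xs ! j)
    = (if j = 0 then 0 else 1) + (if Suc j < length xs then 1 else 0)"
proof -
  have "{xs ! (j - 1), xs ! j} \<noteq> {xs ! j, xs ! Suc j}" if "j \<noteq> 0" "Suc j < length xs"
    using that assms by (auto simp: doubleton_eq_iff nth_eq_iff_index_eq)
  then show ?thesis
    unfolding vertex_order_def edges_at_nth[OF assms] by auto
qed

lemma path_in_segment_trees:
  assumes "xs \<in> paths_from A p"
  shows "path_edges xs \<in> segment_trees A p"
proof -
  have xs: "xs \<noteq> []" "distinct xs" "set xs = A" "hd xs = p"
    using assms by (auto simp: paths_from_def)
  have "tree A (path_edges xs)"
    using grown_path_edges[OF xs(1,2)] grown_is_tree xs(3) by metis
  moreover have "(\<forall>v\<in>A. vertex_order (path_edges xs) v \<in> {1, 2}) \<and> vertex_order (path_edges xs) p = 1"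
    if "A \<noteq> {p}"
  proof -
    have p: "p = xs ! 0"
      using xs by (simp add: hd_conv_nth)
    have l: "length xs > 1"
    proof (rule ccontr)
      assume "\<not> length xs > 1"
      then have "xs = [p]"
        using xs by (cases xs) auto
      then show False
        using that xs(3) by simp
    qed
    have "vertex_order (path_edges xs) (xs ! j) \<in> {1, 2}" if "j < length xs" for j
      using vertex_order_nth[OF xs(2) that] l by auto
    moreover have "vertex_order (path_edges xs) p = 1"
      using vertex_order_nth[OF xs(2), of 0] l p xs(1) by simp
    ultimately show ?thesis
      unfolding xs(3)[symmetric] by (metis in_set_conv_nth)
  qed
  ultimately show ?thesis
    by (auto simp: segment_trees_def)
qed

text \<open>A stem is lengthened one vertex at a time until it covers \<open>A\<close>; the vertex
  orders leave only one way to continue.\<close>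

lemma segment_tree_is_path:
  assumes A: "finite A" "p \<in> A" and T: "T \<in> segment_trees A p"
  shows "T \<in> path_edges ` paths_from A p"
proof -
  have tree: "connected_graph A T" "T \<subseteq> edges A"
    using T by (auto simp: segment_trees_def tree_def)
  have fin: "finite T"
    using tree(2) A(1) finite_edges finite_subset by metis
  have "\<exists>xs. stem p T xs \<and> length xs = Suc n \<and> set xs \<subseteq> A" if "n < card A" for n
    using that
  proof (induction n)
    case 0
    show ?case
      using A(2) by (intro exI[of _ "[p]"]) (simp add: stem_root)
  next
    case (Suc n)
    then obtain xs where xs: "stem p T xs" "length xs = Suc n" "set xs \<subseteq> A"
      by auto
    have ne: "xs \<noteq> []" and dist: "distinct xs" and hd: "hd xs = p" and sub: "path_edges xs \<subseteq> T"
      using xs(1) by (auto simp: stem_def)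
    have "card (set xs) < card A"
      using Suc.prems xs(2) dist by (simp add: distinct_card)
    then have "set xs \<subset> A"
      using xs(3) by auto
    then obtain y where y: "y \<in> A" "y \<notin> set xs" "{last xs, y} \<in> T"
      using stem_crossing[OF tree xs(1)] by metis
    have z: "last xs \<in> A" "last xs \<in> set xs"
      using ne xs(3) by auto
    \<comment> \<open>A vertex off the path excludes the degenerate one-point case, so the
      conditions on vertex orders apply.\<close>
    have "A \<noteq> {p}"
      using y(1,2) ne hd by (metis hd_in_set singletonD)
    then have ord: "vertex_order T (last xs) \<le> 2" "vertex_order T p = 1"
      using T z(1) by (auto simp: segment_trees_def)
    have "z' = y" if z': "z' \<notin> set xs" "{last xs, z'} \<in> T" for z'
    proof (rule ccontr)
      assume "z' \<noteq> y"
      show False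
      \<comment> \<open>At the root, order 1 forbids two continuations. At a later vertex the edge
        back along the path already takes one of at most two places.\<close>
      proof (cases "butlast xs = []")
        case True
        then have "last xs = p"
          using ne hd by (metis append_butlast_last_id append_Nil list.sel(1))
        then have "{{p, y}, {p, z'}} \<subseteq> {e \<in> T. p \<in> e}"
          using y(3) z'(2) by auto
        then have "card {{p, y}, {p, z'}} \<le> vertex_order T p"
          unfolding vertex_order_def using fin by (intro card_mono) auto
        moreover have "{p, y} \<noteq> {p, z'}"
          using \<open>z' \<noteq> y\<close> by (auto simp: doubleton_eq_iff)
        ultimately show False
          using ord(2) by simp
      next
        case False
        define w where "w = last (butlast xs)"
        have w: "w \<in> set xs" "{w, last xs} \<in> T"
          using False sub path_edges_snoc[OF False, of "last xs"] ne
          by (auto simp: w_def dest: in_set_butlastD[OF last_in_set])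
        have "{{last xs, y}, {last xs, z'}, {w, last xs}} \<subseteq> {e \<in> T. last xs \<in> e}"
          using y(3) z'(2) w by auto
        then have "card {{last xs, y}, {last xs, z'}, {w, last xs}} \<le> vertex_order T (last xs)"
          unfolding vertex_order_def using fin by (intro card_mono) auto
        moreover have "{last xs, y} \<noteq> {last xs, z'}" "{last xs, y} \<noteq> {w, last xs}"
          "{last xs, z'} \<noteq> {w, last xs}"
          using \<open>z' \<noteq> y\<close> w(1) y(2) z'(1) z(2) by (auto simp: doubleton_eq_iff)
        ultimately show False
          using ord(1) by simp
      qed
    qed
    then have "stem p T (xs @ [y])"
      using stem_snoc[OF tree(2) xs(1) y(2,3)] by blast
    then show ?case
      using xs y by (intro exI[of _ "xs @ [y]"]) auto
  qed
  moreover have "card A > 0"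
    using A card_gt_0_iff by blast
  ultimately obtain xs where xs: "stem p T xs" "length xs = card A" "set xs \<subseteq> A"
    by (metis Suc_pred' lessI)
  then have "set xs = A"
    using A(1) by (metis card_subset_eq distinct_card stem_def)
  moreover from this have "T = path_edges xs"
    using stem_full[OF tree(2) xs(1)] by blast
  ultimately show ?thesis
    using xs(1) by (auto simp: paths_from_def stem_def)
qed

lemma segment_trees_eq:
  assumes "finite A" "p \<in> A"
  shows "segment_trees A p = path_edges ` paths_from A p"
  by (intro equalityI subsetI) (auto intro: segment_tree_is_path[OF assms] path_in_segment_trees)

section \<open>Colouring edges by rank\<close>

definition colour :: "('a \<Rightarrow> nat) \<Rightarrow> 'a set \<Rightarrow> nat" where
  "colour \<rho> e = Max (\<rho> ` e)"

lemma colour_pair [simp]: "colour \<rho> {u, v} = max (\<rho> u) (\<rho> v)"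
  by (simp add: colour_def)

lemma ex_rank:
  assumes "distinct xs"
  shows "\<exists>\<rho> :: 'a \<Rightarrow> nat. map \<rho> xs = [0..<length xs]"
proof
  have "inv_into {..<length xs} ((!) xs) (xs ! i) = i" if "i < length xs" for i
    using that by (intro inv_into_f_f inj_on_nth[OF assms]) auto
  then show "map (inv_into {..<length xs} ((!) xs)) xs = [0..<length xs]"
    by (intro nth_equalityI) simp_all
qed

text \<open>The larger end of an edge of the path is the later one, so the edge starting at position
  \<open>i\<close> has colour \<open>Suc i\<close>.\<close>

lemma inj_colour_path:
  assumes "map \<rho> xs = [0..<length xs]"
  shows "inj_on (colour \<rho>) (path_edges xs)"
proof -
  have \<rho>: "\<rho> (xs ! i) = i" if "i < length xs" for i
  proof -
    have "\<rho> (xs ! i) = map \<rho> xs ! i"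
      using that by simp
    then show ?thesis
      using that unfolding assms by simp
  qed
  have col: "colour \<rho> {xs ! i, xs ! Suc i} = Suc i" if "Suc i < length xs" for i
    using that by (simp add: \<rho>)
  show ?thesis
  proof (rule inj_onI)
    fix e f assume "e \<in> path_edges xs" "f \<in> path_edges xs" and eq: "colour \<rho> e = colour \<rho> f"
    then obtain i j where "e = {xs ! i, xs ! Suc i}" "Suc i < length xs"
      "f = {xs ! j, xs ! Suc j}" "Suc j < length xs"
      unfolding path_edges_def by blast
    then show "e = f"
      using eq col[of i] col[of j] by simp
  qed
qed

text \<open>At the first descent of the rank along \<open>ys\<close> two consecutive edges would share their
  larger end, hence their colour.\<close>

lemma inj_colour_path_unique:
  assumes xs: "xs \<in> paths_from A p" and ys: "ys \<in> paths_from A p"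
    and \<rho>: "map \<rho> xs = [0..<length xs]" and inj: "inj_on (colour \<rho>) (path_edges ys)"
  shows "ys = xs"
proof -
  have xs': "xs \<noteq> []" "distinct xs" "set xs = A" "hd xs = p"
    and ys': "ys \<noteq> []" "distinct ys" "set ys = A" "hd ys = p"
    using xs ys by (auto simp: paths_from_def)
  have len: "length ys = length xs"
    using xs' ys' distinct_card by metis
  have "distinct (map \<rho> xs)"
    using \<rho> by simp
  then have injA: "inj_on \<rho> A"
    using xs'(3) by (simp add: distinct_map)
  have p0: "\<rho> p = 0"
    using \<rho> xs' by (metis hd_map hd_upt length_greater_0_conv)
  have y0: "ys ! 0 = p"
    using ys' by (simp add: hd_conv_nth)
  have ne: "\<rho> (ys ! i) \<noteq> \<rho> (ys ! j)" if "i < length ys" "j < length ys" "i \<noteq> j" for i j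
    using injA ys' that by (metis inj_on_eq_iff nth_eq_iff_index_eq nth_mem)
  have asc: "\<rho> (ys ! i) < \<rho> (ys ! Suc i)" if "Suc i < length ys" for i
    using that
  proof (induction i)
    case 0
    then show ?case
      using ne[of 0 1] y0 p0 ys'(1) by simp
  next
    case (Suc i)
    show ?case
    proof (rule ccontr)
      assume "\<not> ?thesis"
      then have "colour \<rho> {ys ! i, ys ! Suc i} = colour \<rho> {ys ! Suc i, ys ! Suc (Suc i)}"
        using Suc by simp
      moreover have "{ys ! i, ys ! Suc i} \<in> path_edges ys" "{ys ! Suc i, ys ! Suc (Suc i)} \<in> path_edges ys"
        using Suc.prems by (auto simp: path_edges_def)
      ultimately have "{ys ! i, ys ! Suc i} = {ys ! Suc i, ys ! Suc (Suc i)}"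
        using inj by (meson inj_onD)
      then show False
        using Suc.prems ys'(2) by (auto simp: doubleton_eq_iff nth_eq_iff_index_eq)
    qed
  qed
  \<comment> \<open>Both lists of ranks are increasing and have the same set of values, so they
    coincide.\<close>
  have "sorted (map \<rho> ys)"
    unfolding sorted_iff_nth_Suc using asc by (auto intro: less_imp_le)
  moreover have "distinct (map \<rho> ys)"
    using injA ys' by (simp add: distinct_map)
  moreover have "set (map \<rho> ys) = set (map \<rho> xs)"
    using xs' ys' by simp
  ultimately have "map \<rho> ys = map \<rho> xs"
    unfolding \<rho> by (intro sorted_distinct_set_unique) auto
  then show ?thesis
    using injA xs' ys' by (metis map_inj_on sup.idem)
qed

text \<open>Ranking along \<open>xs\<close> colours the common edge set injectively, and only one
  path from \<open>p\<close> has this property.\<close>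

lemma inj_path_edges: "inj_on path_edges (paths_from A p)"
proof (rule inj_onI)
  fix ys xs assume *: "ys \<in> paths_from A p" "xs \<in> paths_from A p" "path_edges ys = path_edges xs"
  then obtain \<rho> where \<rho>: "map \<rho> xs = [0..<length xs]"
    using ex_rank[of xs] by (auto simp: paths_from_def)
  then have "inj_on (colour \<rho>) (path_edges ys)"
    unfolding *(3) by (rule inj_colour_path)
  then show "ys = xs"
    by (rule inj_colour_path_unique[OF *(2,1) \<rho>])
qed

lemma card_segment_trees:
  assumes "finite A" "p \<in> A"
  shows "card (segment_trees A p) = fact (card A - 1)"
  unfolding segment_trees_eq[OF assms] card_image[OF inj_path_edges] by (rule card_paths_from[OF assms])

text \<open>Two distinct ends cannot both have rank 0. Hence there is one colour fewer than
  vertices, which is the number of edges of a spanning tree.\<close>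

lemma colour_range:
  assumes "inj_on \<rho> A" "\<rho> ` A = {..<card A}" "e \<in> edges A"
  shows "colour \<rho> e \<in> {1..<card A}"
proof -
  obtain u v where e: "e = {u, v}" "u \<noteq> v" "u \<in> A" "v \<in> A"
    using assms(3) by (rule in_edgesE)
  then have "\<rho> u \<noteq> \<rho> v" "\<rho> u < card A" "\<rho> v < card A"
    using assms(1,2) by (auto simp: inj_on_eq_iff)
  then show ?thesis
    using e by auto
qed

text \<open>By counting, every colour occurs. So each vertex of positive rank is the larger end of
  some edge, and following such edges downwards leads to the vertex of rank 0.\<close>

lemma inj_colour_connected:
  assumes A: "finite A" and \<rho>: "inj_on \<rho> A" "\<rho> ` A = {..<card A}"
    and E: "E \<subseteq> edges A" "Suc (card E) = card A" and inj: "inj_on (colour \<rho>) E"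
  shows "connected_graph A E"
proof -
  have "colour \<rho> ` E \<subseteq> {1..<card A}"
    using colour_range[OF \<rho>] E(1) by blast
  moreover have "card (colour \<rho> ` E) = card {1..<card A}"
    using E(2) by (simp add: card_image[OF inj])
  ultimately have all: "colour \<rho> ` E = {1..<card A}"
    by (simp add: card_subset_eq)
  obtain p where p: "p \<in> A" "\<rho> p = 0"
    using \<rho>(2) E(2) by (metis imageE lessThan_iff zero_less_Suc)
  have "(p, x) \<in> {(u, v). {u, v} \<in> E}\<^sup>*" if "x \<in> A" for x
    using that
  proof (induction "\<rho> x" arbitrary: x rule: less_induct)
    case less
    show ?case
    proof (cases "\<rho> x = 0")
      case True
      then have "x = p"
        using p less.prems \<rho>(1) by (metis inj_onD)
      then show ?thesis by simp
    next
      case False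
      moreover have "\<rho> x < card A"
        using \<rho>(2) less.prems by blast
      ultimately have "\<rho> x \<in> colour \<rho> ` E"
        unfolding all by simp
      then obtain e where e: "e \<in> E" "colour \<rho> e = \<rho> x"
        by auto
      have "e \<in> edges A"
        using e(1) E(1) by blast
      then obtain u v where uv: "e = {u, v}" "u \<noteq> v" "u \<in> A" "v \<in> A"
        by (rule in_edgesE)
      have "\<rho> u \<noteq> \<rho> v"
        using \<rho>(1) uv by (simp add: inj_on_eq_iff)
      have "\<exists>w\<in>A. \<rho> w < \<rho> x \<and> e = {w, x}"
      proof (cases "\<rho> u < \<rho> v")
        case True
        then have "v = x"
          using e(2) uv less.prems inj_onD[OF \<rho>(1)] by simp
        then show ?thesis
          using True uv by blast
      next
        case False
        then have "u = x"
          using e(2) uv less.prems inj_onD[OF \<rho>(1)] by simp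
        then show ?thesis
          using False \<open>\<rho> u \<noteq> \<rho> v\<close> uv by (intro bexI[of _ v]) auto
      qed
      then obtain w where "w \<in> A" "\<rho> w < \<rho> x" "{w, x} \<in> E"
        using e(1) by blast
      then show ?thesis
        using less.hyps[of w] by (auto intro: rtrancl.rtrancl_into_rtrancl)
    qed
  qed
  then show ?thesis
    by (rule connected_graph_rootI)
qed

section \<open>Independence\<close>

text \<open>Up to sign, \<open>cochain\<close> is the exterior product over all colours of the 1-cochains that are 1 on
  the edges of one colour; \<open>colour_sign\<close> counts the inversions between \<open>r\<close> and the colour order.\<close>

definition inv_factor :: "('a set \<times> 'a set) set \<Rightarrow> ('a \<Rightarrow> nat) \<Rightarrow> 'a set \<Rightarrow> 'a set \<Rightarrow> int" where
  "inv_factor r \<rho> e f = (if (e, f) \<in> r \<and> colour \<rho> f < colour \<rho> e then - 1 else 1)"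

definition colour_sign :: "('a set \<times> 'a set) set \<Rightarrow> ('a \<Rightarrow> nat) \<Rightarrow> 'a set set \<Rightarrow> int" where
  "colour_sign r \<rho> E = (\<Prod>e\<in>E. \<Prod>f\<in>E. inv_factor r \<rho> e f)"

definition cochain :: "('a set \<times> 'a set) set \<Rightarrow> ('a \<Rightarrow> nat) \<Rightarrow> 'a set set \<Rightarrow> int" where
  "cochain r \<rho> E = (if inj_on (colour \<rho>) E then colour_sign r \<rho> E else 0)"

lemma colour_sign_nonzero: "finite E \<Longrightarrow> colour_sign r \<rho> E \<noteq> 0"
  by (simp add: colour_sign_def inv_factor_def)

text \<open>The new ordered pairs are the two between \<open>w\<close> and each edge of
  \<open>E\<close>; the diagonal pair contributes 1.\<close>

lemma colour_sign_insert:
  assumes "finite E" "w \<notin> E"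
  shows "colour_sign r \<rho> (insert w E)
    = colour_sign r \<rho> E * (\<Prod>e\<in>E. inv_factor r \<rho> e w * inv_factor r \<rho> w e)"
proof -
  have "inv_factor r \<rho> w w = 1"
    by (simp add: inv_factor_def)
  then show ?thesis
    using assms by (simp add: colour_sign_def prod.distrib)
qed

text \<open>This form lets the boundary sign be compared with \<open>colour_sign\<close> factor by
  factor.\<close>

lemma bd_sign_prod:
  assumes "finite B"
  shows "(-1 :: int) ^ card {w \<in> B. (w, v) \<in> r} = (\<Prod>w\<in>B. if (w, v) \<in> r then -1 else 1)"
  using assms by (simp add: prod.If_cases Int_def)

text \<open>The contributions of \<open>B\<close> to the two terms agree. What remains is the order
  of \<open>v\<close> and \<open>w\<close> under \<open>r\<close>, which enters the two terms with
  opposite signs.\<close>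

lemma colour_sign_exchange:
  assumes r: "linear_order_on V r" and B: "finite B" "B \<subseteq> V"
    and vw: "v \<in> V" "w \<in> V" "v \<noteq> w" "v \<notin> B" "w \<notin> B"
    and col: "colour \<rho> v = colour \<rho> w" "\<And>e. e \<in> B \<Longrightarrow> colour \<rho> e \<noteq> colour \<rho> w"
  shows "(-1) ^ card {x \<in> insert w B. (x, v) \<in> r} * colour_sign r \<rho> (insert w B)
    + (-1) ^ card {x \<in> insert v B. (x, w) \<in> r} * colour_sign r \<rho> (insert v B) = 0"
proof -
  define \<beta> :: "'a set \<Rightarrow> 'a set \<Rightarrow> int" where "\<beta> x y = (if (x, y) \<in> r then -1 else 1)" for x y
  have tot: "(x, y) \<in> r \<longleftrightarrow> (y, x) \<notin> r" if "x \<in> V" "y \<in> V" "x \<noteq> y" for x y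
    using r that by (auto simp: order_on_defs total_on_def antisym_def)
  have tr: "(x, z) \<in> r" if "(x, y) \<in> r" "(y, z) \<in> r" for x y z
    using r that by (auto simp: order_on_defs trans_def)
  \<comment> \<open>Each side is -1 to the number of true statements among: \<open>e\<close>
    precedes \<open>v\<close>, \<open>e\<close> precedes \<open>w\<close>, and \<open>e\<close> has
    a smaller colour than theirs. This count is symmetric in \<open>v\<close> and
    \<open>w\<close>.\<close>
  have "\<beta> e v * (inv_factor r \<rho> e w * inv_factor r \<rho> w e)
      = \<beta> e w * (inv_factor r \<rho> e v * inv_factor r \<rho> v e)" if e: "e \<in> B" for e
  proof -
    have "e \<in> V" "e \<noteq> v" "e \<noteq> w"
      using e B vw by auto
    then have t: "(v, e) \<in> r \<longleftrightarrow> (e, v) \<notin> r" "(w, e) \<in> r \<longleftrightarrow> (e, w) \<notin> r"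
      using tot vw by blast+
    show ?thesis
      using col(2)[OF e] by (auto simp: \<beta>_def inv_factor_def t col(1))
  qed
  moreover define P Q where "P x = (\<Prod>e\<in>B. \<beta> e x)"
    and "Q x = (\<Prod>e\<in>B. inv_factor r \<rho> e x * inv_factor r \<rho> x e)" for x
  ultimately have swap: "P v * Q w = P w * Q v"
    unfolding P_def Q_def prod.distrib[symmetric] by (intro prod.cong[OF refl])
  have neg: "\<beta> w v = - \<beta> v w"
    using tot[OF vw(1,2,3)] by (auto simp: \<beta>_def)
  have "(-1) ^ card {x \<in> insert w B. (x, v) \<in> r} = (\<Prod>e\<in>insert w B. \<beta> e v)"
    "(-1) ^ card {x \<in> insert v B. (x, w) \<in> r} = (\<Prod>e\<in>insert v B. \<beta> e w)"
    unfolding \<beta>_def using B(1) by (simp_all only: bd_sign_prod finite_insert)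
  then have "(-1) ^ card {x \<in> insert w B. (x, v) \<in> r} = \<beta> w v * P v"
    "(-1) ^ card {x \<in> insert v B. (x, w) \<in> r} = \<beta> v w * P w"
    using B(1) vw(4,5) by (simp_all only: P_def prod.insert not_False_eq_True)
  moreover have "colour_sign r \<rho> (insert w B) = colour_sign r \<rho> B * Q w"
    "colour_sign r \<rho> (insert v B) = colour_sign r \<rho> B * Q v"
    using B(1) vw(4,5) by (simp_all only: Q_def colour_sign_insert not_False_eq_True)
  ultimately have "(-1) ^ card {x \<in> insert w B. (x, v) \<in> r} * colour_sign r \<rho> (insert w B)
      + (-1) ^ card {x \<in> insert v B. (x, w) \<in> r} * colour_sign r \<rho> (insert v B)
    = colour_sign r \<rho> B * (\<beta> w v * (P v * Q w) + \<beta> v w * (P w * Q v))"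
    by (simp only: distrib_left ac_simps)
  then show ?thesis
    by (simp add: swap neg)
qed

text \<open>A set of edges with one edge more than there are colours has a repeated colour; if a
  single pair of edges is responsible, the two terms that remove one of them cancel.\<close>

lemma cochain_coboundary:
  assumes r: "linear_order_on (edges A) r" and A: "finite A"
    and \<rho>: "inj_on \<rho> A" "\<rho> ` A = {..<card A}"
    and U: "U \<subseteq> edges A" "card U = card A"
  shows "(\<Sum>v\<in>U. (-1) ^ card {x \<in> U - {v}. (x, v) \<in> r} * cochain r \<rho> (U - {v})) = 0"
proof (cases "\<exists>v\<in>U. inj_on (colour \<rho>) (U - {v})")
  case False
  then show ?thesis
    by (intro sum.neutral) (auto simp: cochain_def)
next
  case True
  then obtain v where v: "v \<in> U" "inj_on (colour \<rho>) (U - {v})"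
    by blast
  have fin: "finite U"
    using A U(1) finite_edges finite_subset by metis
  have "\<not> inj_on (colour \<rho>) U"
  proof
    assume "inj_on (colour \<rho>) U"
    moreover have "colour \<rho> ` U \<subseteq> {1..<card A}"
      using colour_range[OF \<rho>] U(1) by blast
    ultimately have "card U \<le> card {1..<card A}"
      by (metis card_inj_on_le finite_atLeastLessThan)
    moreover have "card U > 0"
      using v(1) fin by (auto simp: card_gt_0_iff)
    moreover have "card {1..<card A} = card A - 1"
      by simp
    ultimately show False
      using U(2) by linarith
  qed
  \<comment> \<open>Colours are injective on \<open>U - {v}\<close> but not on \<open>U\<close>, so
    the repeated colour is that of \<open>v\<close>.\<close>
  then have "colour \<rho> v \<in> colour \<rho> ` (U - {v})"
    using v inj_on_insert[of "colour \<rho>" v "U - {v}"] by (simp add: insert_absorb)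
  then obtain w where w: "w \<in> U" "w \<noteq> v" "colour \<rho> v = colour \<rho> w"
    by auto
  define B where "B = U - {v, w}"
  have Uv: "U - {v} = insert w B" and Uw: "U - {w} = insert v B"
    using v w by (auto simp: B_def)
  have B: "finite B" "B \<subseteq> edges A" "v \<notin> B" "w \<notin> B"
    using fin U(1) by (auto simp: B_def)
  have injw: "inj_on (colour \<rho>) (insert w B)"
    using v(2) by (simp add: Uv)
  have ne: "colour \<rho> e \<noteq> colour \<rho> w" if "e \<in> B" for e
    using inj_onD[OF injw, of e w] that B(4) by blast
  have injv: "inj_on (colour \<rho>) (insert v B)"
  proof -
    have "inj_on (colour \<rho>) B"
      by (rule inj_on_subset[OF injw]) blast
    moreover have "colour \<rho> v \<notin> colour \<rho> ` (B - {v})"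
      using ne w(3) by (metis DiffD1 imageE)
    ultimately show ?thesis
      by (rule inj_on_insert[THEN iffD2, OF conjI])
  qed
  \<comment> \<open>Removing any third edge keeps both \<open>v\<close> and \<open>w\<close>, whose
    equal colours make the cochain vanish.\<close>
  have "(\<Sum>x\<in>U. (-1) ^ card {y \<in> U - {x}. (y, x) \<in> r} * cochain r \<rho> (U - {x}))
      = (\<Sum>x\<in>{v, w}. (-1) ^ card {y \<in> U - {x}. (y, x) \<in> r} * cochain r \<rho> (U - {x}))"
  proof (rule sum.mono_neutral_right[OF fin])
    show "{v, w} \<subseteq> U"
      using v w by simp
    show "\<forall>x\<in>U - {v, w}. (-1) ^ card {y \<in> U - {x}. (y, x) \<in> r} * cochain r \<rho> (U - {x}) = 0"
    proof
      fix x assume "x \<in> U - {v, w}"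
      then have "v \<in> U - {x}" "w \<in> U - {x}"
        using v w by auto
      then have "\<not> inj_on (colour \<rho>) (U - {x})"
        using w(2,3) by (metis inj_onD)
      then show "(-1) ^ card {y \<in> U - {x}. (y, x) \<in> r} * cochain r \<rho> (U - {x}) = 0"
        by (simp add: cochain_def)
    qed
  qed
  also have "\<dots> = (-1) ^ card {x \<in> U - {v}. (x, v) \<in> r} * cochain r \<rho> (U - {v})
    + (-1) ^ card {x \<in> U - {w}. (x, w) \<in> r} * cochain r \<rho> (U - {w})"
    using w(2) by simp
  also have "\<dots> = (-1) ^ card {x \<in> insert w B. (x, v) \<in> r} * colour_sign r \<rho> (insert w B)
    + (-1) ^ card {x \<in> insert v B. (x, w) \<in> r} * colour_sign r \<rho> (insert v B)"
    by (simp only: Uv Uw cochain_def injv injw if_True)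
  also have "\<dots> = 0"
    using B v w U(1) ne by (intro colour_sign_exchange[OF r]) auto
  finally show ?thesis .
qed

section \<open>Pairing cochains with chains\<close>

definition evaluate :: "('v set \<Rightarrow> int) \<Rightarrow> 'v chain \<Rightarrow> int" where
  "evaluate \<phi> c = (\<Sum>E\<in>Poly_Mapping.keys c. Poly_Mapping.lookup c E * \<phi> E)"

text \<open>The integers are viewed as the free abelian group on the single generator
  \<open>()\<close>, so that additivity is inherited from \<open>frag_extend\<close>.\<close>

lemma evaluate_frag_extend:
  "evaluate \<phi> c = Poly_Mapping.lookup (frag_extend (\<lambda>E. frag_cmul (\<phi> E) (frag_of ())) c) ()"
  by (simp add: evaluate_def frag_extend_def lookup_sum)

lemma evaluate_zero [simp]: "evaluate \<phi> 0 = 0"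
  by (simp add: evaluate_def)

lemma evaluate_add: "evaluate \<phi> (a + b) = evaluate \<phi> a + evaluate \<phi> b"
  by (simp add: evaluate_frag_extend frag_extend_add lookup_add)

lemma evaluate_diff: "evaluate \<phi> (a - b) = evaluate \<phi> a - evaluate \<phi> b"
  by (simp add: evaluate_frag_extend frag_extend_diff lookup_minus)

lemma evaluate_sum: "evaluate \<phi> (\<Sum>i\<in>I. g i) = (\<Sum>i\<in>I. evaluate \<phi> (g i))"
  by (induction I rule: infinite_finite_induct) (simp_all add: evaluate_add)

lemma evaluate_cmul_of: "evaluate \<phi> (frag_cmul n (frag_of E)) = n * \<phi> E"
  by (simp add: evaluate_frag_extend frag_extend_cmul)

lemma evaluate_cochain_bd:
  assumes r: "linear_order_on (edges A) r" and A: "finite A"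
    and \<rho>: "inj_on \<rho> A" "\<rho> ` A = {..<card A}"
    and u: "u \<in> carrier (chains (Delta A) (int (card A) - 1))"
  shows "evaluate (cochain r \<rho>) (bd r u) = 0"
proof -
  have "Poly_Mapping.keys u \<subseteq> faces (Delta A) (int (card A) - 1)"
    using u by (simp add: carrier_chains)
  then show ?thesis
  proof (induction u rule: frag_induction)
    case zero
    then show ?case by (simp add: bd_zero)
  next
    case (one U)
    then have "U \<subseteq> edges A" "card U = card A"
      by (auto simp: faces_def Delta_def)
    then show ?case
      using cochain_coboundary[OF r A \<rho>, of U]
      by (simp add: bd_def evaluate_sum evaluate_cmul_of)
  next
    case (diff a b)
    then show ?case by (simp add: bd_diff evaluate_diff)
  qed
qed

lemma cochain_disconnected:
  assumes A: "finite A" and \<rho>: "inj_on \<rho> A" "\<rho> ` A = {..<card A}"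
    and E: "E \<in> faces (Mcomplex A) (int (card A) - 2)"
  shows "cochain r \<rho> E = 0"
proof -
  have "E \<subseteq> edges A" "\<not> connected_graph A E" "Suc (card E) = card A"
    using E by (auto simp: faces_def Mcomplex_def Delta_def)
  then show ?thesis
    using inj_colour_connected[OF A \<rho>] by (auto simp: cochain_def)
qed

lemma evaluate_null_chain:
  assumes r: "linear_order_on (edges A) r" and A: "finite A"
    and \<rho>: "inj_on \<rho> A" "\<rho> ` A = {..<card A}"
    and c: "c \<in> null_chains r (Delta A) (Mcomplex A) (int (card A) - 2)"
  shows "evaluate (cochain r \<rho>) c = 0"
proof -
  have 1: "int (card A) - 2 + 1 = int (card A) - 1"
    by simp
  obtain m u where c: "c = m + bd r u" "Poly_Mapping.keys m \<subseteq> faces (Mcomplex A) (int (card A) - 2)"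
    "u \<in> carrier (chains (Delta A) (int (card A) - 1))"
    using c unfolding null_chains_def 1 carrier_chains[of _ "Mcomplex A"] by blast
  have "evaluate (cochain r \<rho>) m = 0"
    unfolding evaluate_def using cochain_disconnected[OF A \<rho>] c(2) by (intro sum.neutral) auto
  then show ?thesis
    using evaluate_cochain_bd[OF r A \<rho> c(3)] by (simp add: c(1) evaluate_add)
qed

lemma segment_trees_independent:
  assumes r: "linear_order_on (edges A) r" and A: "finite A" "p \<in> A"
    and n: "Poly_Mapping.keys n \<subseteq> segment_trees A p"
      "n \<in> null_chains r (Delta A) (Mcomplex A) (int (card A) - 2)"
  shows "n = 0"
proof (rule ccontr)
  assume "n \<noteq> 0"
  then obtain T where T: "T \<in> Poly_Mapping.keys n"
    by (metis all_not_in_conv keys_eq_empty)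
  then obtain xs where xs: "xs \<in> paths_from A p" "T = path_edges xs"
    using n(1) segment_trees_eq[OF A] by blast
  then have xs': "distinct xs" "set xs = A"
    by (auto simp: paths_from_def)
  \<comment> \<open>Ranking along the segment \<open>T\<close> itself makes the cochain dual to it:
    it vanishes on every other segment and so isolates the coefficient of \<open>T\<close>.\<close>
  obtain \<rho> where \<rho>: "map \<rho> xs = [0..<length xs]"
    using ex_rank[OF xs'(1)] by blast
  have "distinct (map \<rho> xs)" "set (map \<rho> xs) = {..<card A}"
    unfolding \<rho> using xs' distinct_card[OF xs'(1)] by auto
  then have inj: "inj_on \<rho> A" "\<rho> ` A = {..<card A}"
    using xs' by (auto simp: distinct_map)
  have "cochain r \<rho> T' = 0" if T': "T' \<in> Poly_Mapping.keys n" "T' \<noteq> T" for T'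
  proof -
    obtain ys where "ys \<in> paths_from A p" "T' = path_edges ys"
      using T'(1) n(1) segment_trees_eq[OF A] by blast
    then show ?thesis
      using inj_colour_path_unique[OF xs(1) _ \<rho>, of ys] T'(2) xs(2) by (auto simp: cochain_def)
  qed
  then have "evaluate (cochain r \<rho>) n = Poly_Mapping.lookup n T * cochain r \<rho> T"
    unfolding evaluate_def using T by (subst sum.remove[OF _ T]) auto
  moreover have "cochain r \<rho> T \<noteq> 0"
  proof -
    have "finite T"
      unfolding xs(2) by (rule finite_subset[OF path_edges_subset]) simp
    then show ?thesis
      using inj_colour_path[OF \<rho>] colour_sign_nonzero xs(2) by (simp add: cochain_def)
  qed
  ultimately show False
    using evaluate_null_chain[OF r A(1) inj n(2)] T by (simp add: in_keys_iff)
qed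

section \<open>Spanning\<close>

text \<open>Every use of the edge \<open>{x, y}\<close> can be replaced by the detour through
  \<open>z\<close>.\<close>

lemma connected_graph_triangle:
  assumes "connected_graph A E" "{x, z} \<in> F" "{z, y} \<in> F" "E \<subseteq> insert {x, y} F"
  shows "connected_graph A F"
proof -
  let ?R = "{(u, v). {u, v} \<in> F}\<^sup>*"
  have xy: "(x, y) \<in> ?R" "(y, x) \<in> ?R"
    using assms(2,3) by (auto simp: insert_commute intro: rtrancl_into_rtrancl r_into_rtrancl)
  have "(u, v) \<in> ?R" if "{u, v} \<in> E" for u v
  proof (cases "{u, v} \<in> F")
    case False
    then have "{u, v} = {x, y}"
      using assms(4) that by blast
    then show ?thesis
      using xy by (auto simp: doubleton_eq_iff)
  qed auto
  then have "{(u, v). {u, v} \<in> E}\<^sup>* \<subseteq> ?R"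
    by (intro rtrancl_subset_rtrancl) auto
  then show ?thesis
    using assms(1) unfolding connected_graph_def by blast
qed

text \<open>Deleting one side of a triangle would preserve connectedness but leave fewer than
  \<open>card A - 1\<close> edges.\<close>

lemma connected_graph_triangle_free:
  assumes A: "finite A" "A \<noteq> {}" and E: "connected_graph A E" "E \<subseteq> edges A" "card E < card A"
    and "{x, z} \<in> E" "{z, y} \<in> E" "z \<noteq> x" "z \<noteq> y"
  shows "{x, y} \<notin> E"
proof
  assume xy: "{x, y} \<in> E"
  have fin: "finite E"
    using A(1) E(2) finite_edges finite_subset by metis
  have "connected_graph A (E - {{x, y}})"
    using assms(6-9) by (intro connected_graph_triangle[OF E(1), of x z _ y]) (auto simp: doubleton_eq_iff)
  then have "card A \<le> Suc (card (E - {{x, y}}))"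
    using E(2) by (intro card_connected_graph[OF A]) auto
  also have "\<dots> = card E"
    by (rule card.remove[OF fin xy, symmetric])
  finally show False
    using E(3) by simp
qed

abbreviation tree_null_chains :: "('a set \<times> 'a set) set \<Rightarrow> 'a set \<Rightarrow> 'a set chain set" where
  "tree_null_chains r A \<equiv> null_chains r (Delta A) (Mcomplex A) (int (card A) - 2)"

definition spanned :: "('a set \<times> 'a set) set \<Rightarrow> 'a set \<Rightarrow> 'a \<Rightarrow> 'a set chain \<Rightarrow> bool" where
  "spanned r A p c \<longleftrightarrow>
    (\<exists>n. Poly_Mapping.keys n \<subseteq> segment_trees A p \<and> c - n \<in> tree_null_chains r A)"

lemma spanned_null: "c \<in> tree_null_chains r A \<Longrightarrow> spanned r A p c"
  unfolding spanned_def by (intro exI[of _ 0]) auto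

lemma spanned_zero: "spanned r A p 0"
  by (simp add: spanned_null null_chains_zero)

lemma spanned_diff:
  assumes "spanned r A p a" "spanned r A p b"
  shows "spanned r A p (a - b)"
proof -
  obtain m n where mn: "Poly_Mapping.keys m \<subseteq> segment_trees A p" "a - m \<in> tree_null_chains r A"
    "Poly_Mapping.keys n \<subseteq> segment_trees A p" "b - n \<in> tree_null_chains r A"
    using assms unfolding spanned_def by blast
  have "(a - b) - (m - n) \<in> tree_null_chains r A"
    using null_chains_diff[OF mn(2,4)] by (simp add: algebra_simps)
  moreover have "Poly_Mapping.keys (m - n) \<subseteq> segment_trees A p"
    using keys_diff[of m n] mn by blast
  ultimately show ?thesis
    unfolding spanned_def by blast
qed

lemma spanned_uminus: "spanned r A p a \<Longrightarrow> spanned r A p (- a)"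
  using spanned_diff[OF spanned_zero] by fastforce

lemma spanned_add:
  assumes "spanned r A p a" "spanned r A p b"
  shows "spanned r A p (a + b)"
  using spanned_diff[OF assms(1) spanned_uminus[OF assms(2)]] by simp

lemma spanned_sum: "(\<And>i. i \<in> I \<Longrightarrow> spanned r A p (g i)) \<Longrightarrow> spanned r A p (\<Sum>i\<in>I. g i)"
  by (induction I rule: infinite_finite_induct) (simp_all add: spanned_zero spanned_add)

text \<open>This serves to drop the incidence signs in a boundary.\<close>

lemma spanned_unit_cmul:
  assumes "n = 1 \<or> n = -1"
  shows "spanned r A p (frag_cmul n c) \<longleftrightarrow> spanned r A p c"
  using assms spanned_uminus[of r A p c] spanned_uminus[of r A p "- c"] by auto

lemma spanned_disconnected:
  assumes "E \<subseteq> edges A" "finite A" "Suc (card E) = card A" "\<not> connected_graph A E"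
  shows "spanned r A p (frag_of E)"
proof -
  have "finite E"
    using assms finite_edges finite_subset by metis
  then have "E \<in> faces (Mcomplex A) (int (card A) - 2)"
    using assms by (auto simp: faces_def Mcomplex_def Delta_def)
  then have "frag_of E \<in> tree_null_chains r A"
    unfolding null_chains_def carrier_chains mem_Collect_eq
    by (intro exI[of _ "frag_of E"] exI[of _ 0]) (auto simp: bd_zero)
  then show ?thesis
    by (rule spanned_null)
qed

text \<open>Adding an edge that closes a triangle gives a boundary with only three connected terms:
  deleting an edge off the triangle leaves too few edges to connect \<open>A\<close>.\<close>

lemma spanned_triangle:
  assumes A: "finite A" and T: "T \<subseteq> edges A" "connected_graph A T" "Suc (card T) = card A"
    and e: "{z, a} \<in> T" "{z, b} \<in> T" "a \<noteq> b"
    and sa: "spanned r A p (frag_of (insert {a, b} T - {{z, a}}))"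
    and sb: "spanned r A p (frag_of (insert {a, b} T - {{z, b}}))"
  shows "spanned r A p (frag_of T)"
proof -
  define U where "U = insert {a, b} T"
  define \<epsilon> :: "'a set \<Rightarrow> int" where "\<epsilon> v = (-1) ^ card {w \<in> U - {v}. (w, v) \<in> r}" for v
  have zab: "z \<in> A" "a \<in> A" "b \<in> A" "z \<noteq> a" "z \<noteq> b" and ne: "A \<noteq> {}"
    using subsetD[OF T(1) e(1)] subsetD[OF T(1) e(2)] by auto
  \<comment> \<open>Since \<open>{a, b}\<close> is a new edge, \<open>U\<close> has exactly
    \<open>card A\<close> edges and its boundary lies in the right dimension.\<close>
  have new: "{a, b} \<notin> T"
    using e zab T by (intro connected_graph_triangle_free[OF A ne T(2,1), of a z b])
      (auto simp: insert_commute)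
  have fin: "finite T"
    using A T(1) finite_edges finite_subset by metis
  have U: "finite U" "U \<subseteq> edges A" "card U = card A"
    using fin T new zab e(3) by (auto simp: U_def)
  have "U \<in> faces (Delta A) (int (card A) - 2 + 1)"
    using U by (auto simp: faces_def Delta_def)
  then have "bd r (frag_of U) \<in> tree_null_chains r A"
    unfolding null_chains_def carrier_chains mem_Collect_eq
    by (intro exI[of _ 0] exI[of _ "frag_of U"]) auto
  then have all: "spanned r A p (\<Sum>v\<in>U. frag_cmul (\<epsilon> v) (frag_of (U - {v})))" (is "spanned r A p (sum ?t U)")
    by (intro spanned_null) (simp add: bd_def \<epsilon>_def)
  have unit: "\<epsilon> v = 1 \<or> \<epsilon> v = -1" for v
    unfolding \<epsilon>_def by (metis neg_one_even_power neg_one_odd_power)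
  have others: "spanned r A p (?t v)" if v: "v \<in> U - {{a, b}}" for v
  proof -
    have "spanned r A p (frag_of (U - {v}))"
    proof (cases "v = {z, a} \<or> v = {z, b}")
      case True
      then show ?thesis
        using sa sb by (auto simp: U_def)
    next
      case False
      have card: "Suc (card (U - {v})) = card A"
        using card.remove[OF U(1), of v] v U(3) by simp
      have "\<not> connected_graph A (U - {v})"
      proof
        assume "connected_graph A (U - {v})"
        then have "{a, b} \<notin> U - {v}"
          using U(2) card False e zab
          by (intro connected_graph_triangle_free[OF A ne, of "U - {v}" a z b])
            (auto simp: U_def insert_commute)
        then show False
          using v by (auto simp: U_def)
      qed
      then show ?thesis
        using U(2) card by (intro spanned_disconnected A) auto
    qed
    then show ?thesis
      by (simp only: spanned_unit_cmul[OF unit])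
  qed
  \<comment> \<open>The boundary relation is solved for the term that deletes \<open>{a, b}\<close>,
    whose face is \<open>T\<close> itself.\<close>
  have "sum ?t U = ?t {a, b} + sum ?t (U - {{a, b}})"
    by (rule sum.remove[OF U(1)]) (simp add: U_def)
  then have "sum ?t U - sum ?t (U - {{a, b}}) = ?t {a, b}"
    by simp
  moreover have "spanned r A p (sum ?t U - sum ?t (U - {{a, b}}))"
    by (rule spanned_diff[OF all spanned_sum[OF others]])
  ultimately have "spanned r A p (?t {a, b})"
    by (simp only:)
  moreover have "U - {{a, b}} = T"
    using new by (simp add: U_def)
  ultimately show ?thesis
    by (simp only: spanned_unit_cmul[OF unit])
qed

section \<open>Straightening a tree along its stem\<close>

definition branches :: "'a set set \<Rightarrow> 'a list \<Rightarrow> 'a set" where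
  "branches T xs = {y. y \<notin> set xs \<and> {last xs, y} \<in> T}"

lemma finite_branches:
  assumes "finite A" "T \<subseteq> edges A"
  shows "finite (branches T xs)"
proof (rule finite_subset[OF _ assms(1)])
  show "branches T xs \<subseteq> A"
    unfolding branches_def by (auto dest!: subsetD[OF assms(2)])
qed

text \<open>The exchange moves the branch at \<open>a\<close> from the end of the stem onto
  \<open>b\<close>. As \<open>a\<close> and \<open>b\<close> are both off the stem, the edges at its
  earlier vertices do not change.\<close>

lemma stem_slide:
  assumes stem: "stem p T xs" and ab: "a \<in> branches T xs" "b \<in> branches T xs" "a \<noteq> b"
  shows "stem p (insert {a, b} T - {{last xs, a}}) xs"
    and "branches (insert {a, b} T - {{last xs, a}}) xs = branches T xs - {a}"
proof -
  have xs: "xs \<noteq> []" "a \<notin> set xs" "b \<notin> set xs"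
    using stem ab by (auto simp: stem_def branches_def)
  have "{last xs, a} \<notin> path_edges xs"
    using path_edges_subset[of xs] xs(2) by blast
  moreover have "{a, b} \<inter> set (butlast xs) = {}"
    using xs by (auto dest: in_set_butlastD)
  ultimately show "stem p (insert {a, b} T - {{last xs, a}}) xs"
    using stem unfolding stem_def by blast
  have "last xs \<in> set xs"
    using xs(1) by simp
  then have "last xs \<noteq> a" "last xs \<noteq> b"
    using xs by auto
  then show "branches (insert {a, b} T - {{last xs, a}}) xs = branches T xs - {a}"
    by (auto simp: branches_def doubleton_eq_iff)
qed

text \<open>The outer induction is on the number of vertices off the stem, the inner one on the
  number of branches at its end. A single branch lengthens the stem; two branches allow a triangle
  exchange, and both resulting trees have one branch fewer.\<close>

lemma spanned_stem:
  assumes A: "finite A" "p \<in> A"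
    and "T \<subseteq> edges A" "connected_graph A T" "Suc (card T) = card A"
    and "stem p T xs" "set xs \<subseteq> A"
  shows "spanned r A p (frag_of T)"
  using assms(3-)
proof (induction "card A - length xs" arbitrary: T xs rule: less_induct)
  case (less xs T)
  \<comment> \<open>The outer hypothesis is saved under this name because the inner induction reuses
    \<open>less\<close>.\<close>
  note longer = less.hyps
  show ?case
    using less.prems
  proof (induction "card (branches T xs)" arbitrary: T rule: less_induct)
    case (less T)
    note T = less.prems(1-3) and stem = less.prems(4) and sub = less.prems(5)
    have fin: "finite T" "finite (branches T xs)"
      using A(1) T(1) finite_edges finite_subset finite_branches by metis+
    have xs: "xs \<noteq> []" "distinct xs" "hd xs = p"
      using stem by (auto simp: stem_def)
    show ?case
    proof (cases "set xs = A")
      case True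
      then have "T \<in> segment_trees A p"
        using stem_full[OF T(1) stem True] xs path_in_segment_trees[of xs A p]
        by (simp add: paths_from_def)
      then show ?thesis
        unfolding spanned_def by (intro exI[of _ "frag_of T"]) (simp add: null_chains_zero)
    next
      case False
      then have psub: "set xs \<subset> A"
        using sub by blast
      obtain a where a: "a \<in> A" "a \<notin> set xs" "{last xs, a} \<in> T"
        using stem_crossing[OF T(2,1) stem psub] by metis
      then have aB: "a \<in> branches T xs"
        by (simp add: branches_def)
      show ?thesis
      proof (cases "branches T xs = {a}")
        case True
        then have "z = a" if "z \<notin> set xs" "{last xs, z} \<in> T" for z
          using that by (auto simp: branches_def)
        then have "stem p T (xs @ [a])"
          using stem_snoc[OF T(1) stem a(2,3)] by blast
        \<comment> \<open>The measure is a truncated subtraction, so it drops only because some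
          vertex is still missing.\<close>
        moreover have "length xs < card A"
          using psub A(1) xs(2) psubset_card_mono distinct_card by metis
        ultimately show ?thesis
          using longer[of "xs @ [a]" T] T sub a(1) by simp
      next
        case False
        then obtain b where b: "b \<in> branches T xs" "a \<noteq> b"
          using aB by blast
        have bb: "b \<in> A" "{last xs, b} \<in> T"
          using b T(1) by (auto simp: branches_def dest: subsetD)
        have z: "last xs \<noteq> a" "last xs \<noteq> b" "A \<noteq> {}"
          using xs(1) a b by (auto simp: branches_def)
        have new: "{a, b} \<notin> T"
          using T a(3) bb(2) z
          by (intro connected_graph_triangle_free[OF A(1) z(3) T(2,1), of a "last xs" b])
            (auto simp: insert_commute)
        \<comment> \<open>Stated for \<open>c\<close> and \<open>d\<close> so that it covers both
          exchanges, with \<open>a\<close> and \<open>b\<close> in either order.\<close>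
        have slide: "spanned r A p (frag_of (insert {c, d} T - {{last xs, c}}))"
          if cd: "{c, d} = {a, b}" "c \<in> branches T xs" "d \<in> branches T xs" "c \<noteq> d" for c d
        proof (rule less.hyps)
          let ?T = "insert {c, d} T - {{last xs, c}}"
          have cd': "c \<in> A" "d \<in> A" "{last xs, c} \<in> T" "{last xs, d} \<in> T" "last xs \<noteq> c" "last xs \<noteq> d"
            using cd a bb z by (auto simp: doubleton_eq_iff)
          show "?T \<subseteq> edges A"
            using T(1) cd' cd(4) by auto
          show "connected_graph A ?T"
            by (rule connected_graph_triangle[OF T(2), of "last xs" d _ c])
              (use cd' cd(4) in \<open>auto simp: doubleton_eq_iff\<close>)
          show "Suc (card ?T) = card A"
            using card.remove[of "insert {c, d} T" "{last xs, c}"] fin(1) new cd(1) cd'(3) T(3)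
            by simp
          show "stem p ?T xs"
            by (rule stem_slide(1)[OF stem cd(2-4)])
          show "card (branches ?T xs) < card (branches T xs)"
            unfolding stem_slide(2)[OF stem cd(2-4)] by (rule card_Diff1_less[OF fin(2) cd(2)])
        qed (rule sub)
        show ?thesis
          using slide[of a b] slide[of b a] aB b
          by (intro spanned_triangle[OF A(1) T a(3) bb(2) b(2)]) (auto simp: insert_commute)
      qed
    qed
  qed
qed

lemma spanned_chain:
  assumes A: "finite A" "p \<in> A" and c: "c \<in> carrier (chains (Delta A) (int (card A) - 2))"
  shows "spanned r A p c"
proof -
  have "Poly_Mapping.keys c \<subseteq> faces (Delta A) (int (card A) - 2)"
    using c by (simp add: carrier_chains)
  then show ?thesis
  proof (induction c rule: frag_induction)
    case zero
    then show ?case by (rule spanned_zero)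
  next
    case (one E)
    then have E: "E \<subseteq> edges A" "Suc (card E) = card A"
      by (auto simp: faces_def Delta_def)
    show ?case
    proof (cases "connected_graph A E")
      case True
      \<comment> \<open>The one-vertex path at \<open>p\<close> is a stem of any graph and starts
        the induction.\<close>
      show ?thesis
        by (rule spanned_stem[OF A E(1) True E(2) stem_root]) (simp add: A(2))
    next
      case False
      show ?thesis
        by (rule spanned_disconnected[OF E(1) A(1) E(2) False])
    qed
  next
    case (diff a b)
    then show ?case by (blast intro: spanned_diff)
  qed
qed

section \<open>Application to the complex of connected graphs\<close>

lemma complex_pair_connected_graphs:
  assumes "finite A" "A \<noteq> {}"
  shows "complex_pair (Delta A) (Mcomplex A) (int (card A) - 2)"
proof
  show "G \<in> Delta A" if "F \<in> Delta A" "G \<subseteq> F" for F G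
    using that by (auto simp: Delta_def)
  show "G \<in> Mcomplex A" if "F \<in> Mcomplex A" "G \<subseteq> F" for F G
    using that connected_graph_mono by (fastforce simp: Mcomplex_def Delta_def)
  show "Mcomplex A \<subseteq> Delta A"
    by (auto simp: Mcomplex_def)
  \<comment> \<open>A face of dimension \<open>card A - 3\<close> has \<open>card A - 2\<close>
    edges, one too few to connect \<open>A\<close>.\<close>
  show "faces (Delta A) (int (card A) - 2 - 1) \<subseteq> Mcomplex A"
  proof
    fix F assume "F \<in> faces (Delta A) (int (card A) - 2 - 1)"
    then have "F \<subseteq> edges A" "int (card F) = int (card A) - 2"
      by (auto simp: faces_def Delta_def)
    then show "F \<in> Mcomplex A"
      using card_connected_graph[OF assms, of F] by (auto simp: Mcomplex_def Delta_def)
  qed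
qed

text \<open>A tree has \<open>card A - 1\<close> edges, one more than its dimension as a face. On a
  single vertex it is the empty face, of dimension -1.\<close>

lemma tree_face:
  assumes "finite A" "A \<noteq> {}" "tree A T"
  shows "T \<in> faces (Delta A) (int (card A) - 2)"
proof -
  have "finite T"
    using assms finite_edges finite_subset by (metis tree_def)
  then show ?thesis
    using card_tree[OF assms] assms(3) by (auto simp: faces_def Delta_def tree_def)
qed

theorem theorem2:
  fixes A :: "'a set" and p :: 'a and k :: nat
    and r :: "('a set \<times> 'a set) set" and s :: "'a set set \<Rightarrow> int"
  assumes "finite A" and "card A = k" and "k \<ge> 1" and "p \<in> A"
    and "linear_order_on (edges A) r"
    and "\<And>T. tree A T \<Longrightarrow> s T = 1 \<or> s T = -1"
  shows "(\<forall>T. tree A T \<longrightarrow> card T = k - 1 \<and>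
            K_class A (int k - 2) (frag_cmul (s T) (frag_of T)) \<in> K_cycles r A (int k - 2))
       \<and> card (segment_trees A p) = fact (k - 1)
       \<and> abelian_basis (H_K r A (int k - 2)) (segment_trees A p)
           (\<lambda>T. H_K_class r A (int k - 2) (frag_cmul (s T) (frag_of T)))"
proof (intro conjI allI impI)
  have A: "finite A" "A \<noteq> {}" "p \<in> A" and k: "k = card A"
    using assms by auto
  interpret complex_pair r "Delta A" "Mcomplex A" "int (card A) - 2"
    by (rule complex_pair_connected_graphs[OF A(1,2)])
  show "card T = k - 1" if "tree A T" for T
    using card_tree[OF A(1,2) that] k by simp
  show "K_class A (int k - 2) (frag_cmul (s T) (frag_of T)) \<in> K_cycles r A (int k - 2)"
    if "tree A T" for T
  proof -
    have "frag_cmul (s T) (frag_of T) \<in> carrier (chains (Delta A) (int (card A) - 2))"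
      using tree_face[OF A(1,2) that] by (auto simp: carrier_chains split: if_splits)
    then show ?thesis
      \<comment> \<open>In this dimension all relative chains are cycles, so it is enough that the
        tree is a face.\<close>
      unfolding k quot_cycles_eq carrier_quot_chains by (rule imageI)
  qed
  show "card (segment_trees A p) = fact (k - 1)"
    unfolding k by (rule card_segment_trees[OF A(1,3)])
  show "abelian_basis (H_K r A (int k - 2)) (segment_trees A p)
      (\<lambda>T. H_K_class r A (int k - 2) (frag_cmul (s T) (frag_of T)))"
    unfolding k
  proof (rule abelian_basis_homologyI)
    show "segment_trees A p \<subseteq> faces (Delta A) (int (card A) - 2)"
      using tree_face[OF A(1,2)] by (auto simp: segment_trees_def)
    show "s T = 1 \<or> s T = -1" if "T \<in> segment_trees A p" for T
      using that assms(6) by (simp add: segment_trees_def)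
    show "\<exists>n. Poly_Mapping.keys n \<subseteq> segment_trees A p \<and> c - n \<in> tree_null_chains r A"
      if "c \<in> carrier (chains (Delta A) (int (card A) - 2))" for c
      using spanned_chain[OF A(1,3) that] by (simp add: spanned_def)
    show "n = 0" if "Poly_Mapping.keys n \<subseteq> segment_trees A p" "n \<in> tree_null_chains r A" for n
      using segment_trees_independent[OF assms(5) A(1,3) that] .
  qed
qed

end
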